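(* There exists a constant $k>0$ such that $$\overline{\delta}_{JT_*}(\varepsilon)\ \geq\ k\,\varepsilon^3\qquad\text{for each }\varepsilon\in(0,1].$$ Thus $JT_*$, the predual of the James tree space $JT$, is asymptotically uniformly convex.
   Context: All Banach spaces are real. For a Banach space $\mathfrak X$, $S(\mathfrak X)$ is its unit sphere. Let $\mathfrak N(\mathfrak X)$ be the collection of all norm-closed finite-codimensional subspaces of $\mathfrak X$, i.e. the subspaces $\{x\in\mathfrak X: x_i^*(x)=0,\ 1\le i\le n\}$ with $n\in\mathbb N$, $x_i^*\in\mathfrak X^*$. For an infinite-dimensional Banach space $\mathfrak X$, the modulus of asymptotic convexity $\overline{\delta}_{\mathfrak X}:[0,1]\to[0,1]$ is $$\overline{\delta}_{\mathfrak X}(\varepsilon)=\inf_{x\in S(\mathfrak X)}\ \sup_{\mathcal Y\in\mathfrak N(\mathfrak X)}\ \inf_{y\in S(\mathcal Y)}\big[\,\|x+\varepsilon y\|-1\,\big],$$ and $\mathfrak X$ is asymptotically uniformly convex if $\overline{\delta}_{\mathfrak X}(\varepsilon)>0$ for each $\varepsilon\in(0,1]$. The James tree space. Let $\Delta_0=\{\emptyset\}$, $\Delta_n=\{-1,+1\}^n$ for $n\in\mathbb N$, and $\mathcal T=\bigcup_{n=0}^\infty\Delta_n$ (the binary tree), ordered by: $t_1<t_2$ if either $t_1=\emptyset$ and $t_2\neq\emptyset$, or $t_1\in\Delta_n$, $t_2\in\Delta_m$ with $1\le n<m$ and $t_1$ consists of the first $n$ coordinates of $t_2$. A segment of $\mathcal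 T$ is a finite linearly ordered subset $\{t_n,t_{n+1},\dots,t_{n+k}\}$ with $t_i\in\Delta_i$ for $n\le i\le n+k$. $JT$ is the completion of the space of finitely supported functions $x:\mathcal T\to\mathbb R$ under the norm $$\|x\|_{JT}=\sup\Big\{\Big[\sum_{i=1}^n\Big|\sum_{t\in S_i}x_t\Big|^2\Big]^{1/2}: S_1,\dots,S_n\text{ disjoint segments of }\mathcal T\Big\}.$$ For $t\in\mathcal T$, let $\eta_t\in JT$ be the function with $\eta_t(t)=1$ and $\eta_t(s)=0$ for $s\ne t$. With $\mathcal T$ ordered lexicographically (level by level), $\{\eta_t\}_{t\in\mathcal T}$ is a monotone boundedly complete Schauder basis of $JT$ with biorthogonal functionals $\{\eta_t^*\}_{t\in\mathcal T}\subset JT^*$. The predual $JT_*$ of $JT$ is identified isometrically (via the canonical embedding into its bidual $JT^*$) with the closed linear span of $\{\eta_t^*\}_{t\in\mathcal T}$ in $JT^*$, with the norm of $JT^*$. *)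

theory Defs
  imports "HOL-Analysis.Analysis" "HOL-Library.Sublist"
begin

section \<open>Asymptotic uniform convexity\<close>

class infinite_dimensional_banach = banach +
  assumes not_finite_dimensional:
    "finite B \<Longrightarrow> \<exists>x. \<forall>u. x \<noteq> (\<Sum>b\<in>B. u b *\<^sub>R b)"

definition finite_codim_closed_subspaces :: "'a::real_normed_vector set set" where
  "finite_codim_closed_subspaces =
     {Y. \<exists>(n::nat) f :: nat \<Rightarrow> 'a \<Rightarrow>\<^sub>L real. Y = {x. \<forall>i\<in>{1..n}. blinfun_apply (f i) x = 0}}"

text \<open>All infima and suprema below are taken over nonempty sets of reals contained in
  \<open>[-\<bar>\<epsilon>\<bar>, \<bar>\<epsilon>\<bar>]\<close>: a finite-codimensional subspace of an infinite-dimensional space has a nonempty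
  unit sphere.\<close>

definition asymptotic_convexity_modulus ::
  "'a::infinite_dimensional_banach itself \<Rightarrow> real \<Rightarrow> real" where
  "asymptotic_convexity_modulus _ \<epsilon> =
     (INF x \<in> sphere (0::'a) 1. SUP Y \<in> finite_codim_closed_subspaces.
        INF y \<in> Y \<inter> sphere 0 1. norm (x + \<epsilon> *\<^sub>R y) - 1)"

definition asymptotically_uniformly_convex :: "'a::infinite_dimensional_banach itself \<Rightarrow> bool" where
  "asymptotically_uniformly_convex X \<longleftrightarrow>
     (\<forall>\<epsilon>\<in>{0<..1}. asymptotic_convexity_modulus X \<epsilon> > 0)"


section \<open>The James tree space\<close>

text \<open>A node in \<open>{-1,+1}\<^sup>n\<close> is encoded as a list of \<open>n\<close> Booleans; the tree order is then the
  prefix order on lists.\<close>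

type_synonym node = "bool list"

definition is_segment :: "node set \<Rightarrow> bool" where
  "is_segment S \<longleftrightarrow>
     (\<exists>n k (t :: nat \<Rightarrow> node). S = t ` {n..n+k} \<and> (\<forall>i\<in>{n..n+k}. length (t i) = i) \<and>
        (\<forall>i\<in>{n..n+k}. \<forall>j\<in>{n..n+k}. prefix (t i) (t j) \<or> prefix (t j) (t i)))"

definition segment_families :: "node set set set" where
  "segment_families = {F. finite F \<and> (\<forall>S\<in>F. is_segment S) \<and> pairwise disjnt F}"

definition jt_value :: "node set set \<Rightarrow> (node \<Rightarrow> real) \<Rightarrow> real" where
  "jt_value F x = sqrt (\<Sum>S\<in>F. \<bar>\<Sum>t\<in>S. x t\<bar>\<^sup>2)"

definition jt_norm :: "(node \<Rightarrow> real) \<Rightarrow> real" where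
  "jt_norm x = (SUP F\<in>segment_families. jt_value F x)"

text \<open>The completion is realised inside the functions of finite \<open>jt_norm\<close>, as the closure of the
  finitely supported ones. That this is the completion is established below: the resulting type is
  an instance of class \<open>banach\<close>, its norm is \<open>jt_norm\<close>, and the finitely supported functions
  belong to it and are dense (\<open>closure_span_jt_basis\<close>).\<close>

definition finitely_supported :: "(node \<Rightarrow> real) \<Rightarrow> bool" where
  "finitely_supported x \<longleftrightarrow> finite {t. x t \<noteq> 0}"

definition jt_bounded :: "(node \<Rightarrow> real) \<Rightarrow> bool" where
  "jt_bounded x \<longleftrightarrow> bdd_above ((\<lambda>F. jt_value F x) ` segment_families)"

definition jt_carrier :: "(node \<Rightarrow> real) set" where
  "jt_carrier = {x. jt_bounded x \<and>
     (\<forall>e>0. \<exists>y. finitely_supported y \<and> jt_norm (\<lambda>t. x t - y t) < e)}"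

lemma jt_value_L2: "jt_value F x = L2_set (\<lambda>S. \<Sum>t\<in>S. x t) F"
  by (simp add: jt_value_def L2_set_def)

lemma empty_segment_families: "{} \<in> segment_families"
  by (simp add: segment_families_def)

lemma is_segment_finite: "is_segment S \<Longrightarrow> finite S"
  by (auto simp: is_segment_def)

lemma is_segment_singleton: "is_segment {t}"
  unfolding is_segment_def
  by (rule exI[of _ "length t"], rule exI[of _ 0], rule exI[of _ "\<lambda>_. t"]) auto

lemma jt_value_le_norm:
  assumes "jt_bounded x" "F \<in> segment_families"
  shows "jt_value F x \<le> jt_norm x"
  unfolding jt_norm_def using assms by (auto simp: jt_bounded_def intro: cSUP_upper)

lemma jt_norm_leI:
  assumes "\<And>F. F \<in> segment_families \<Longrightarrow> jt_value F x \<le> c"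
  shows "jt_norm x \<le> c"
  unfolding jt_norm_def using assms empty_segment_families by (intro cSUP_least) auto

lemma jt_boundedI:
  assumes "\<And>F. F \<in> segment_families \<Longrightarrow> jt_value F x \<le> c"
  shows "jt_bounded x"
  unfolding jt_bounded_def using assms by (auto intro!: bdd_aboveI[of _ c])

lemma jt_norm_nonneg: "jt_bounded x \<Longrightarrow> 0 \<le> jt_norm x"
  using jt_value_le_norm[OF _ empty_segment_families] by (simp add: jt_value_def)

lemma jt_abs_le_norm:
  assumes "jt_bounded x" shows "\<bar>x t\<bar> \<le> jt_norm x"
proof -
  have "{{t}} \<in> segment_families"
    by (simp add: segment_families_def is_segment_singleton)
  from jt_value_le_norm[OF assms this] show ?thesis by (simp add: jt_value_def)
qed

lemma jt_value_add: "jt_value F (\<lambda>t. x t + y t) \<le> jt_value F x + jt_value F y"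
  unfolding jt_value_L2 sum.distrib by (rule L2_set_triangle_ineq)

lemma jt_value_scale: "jt_value F (\<lambda>t. c * x t) = \<bar>c\<bar> * jt_value F x"
  unfolding jt_value_def
  by (simp add: sum_distrib_left[symmetric] power_mult_distrib real_sqrt_mult)

lemma jt_norm_add:
  assumes "jt_bounded x" "jt_bounded y"
  shows "jt_bounded (\<lambda>t. x t + y t)" "jt_norm (\<lambda>t. x t + y t) \<le> jt_norm x + jt_norm y"
proof -
  have *: "jt_value F (\<lambda>t. x t + y t) \<le> jt_norm x + jt_norm y" if "F \<in> segment_families" for F
    using jt_value_add[of F x y] jt_value_le_norm[OF assms(1) that] jt_value_le_norm[OF assms(2) that]
    by linarith
  show "jt_bounded (\<lambda>t. x t + y t)" "jt_norm (\<lambda>t. x t + y t) \<le> jt_norm x + jt_norm y"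
    using jt_boundedI[OF *] jt_norm_leI[OF *] by auto
qed

lemma jt_norm_scale_le:
  assumes "jt_bounded x"
  shows "jt_bounded (\<lambda>t. c * x t)" "jt_norm (\<lambda>t. c * x t) \<le> \<bar>c\<bar> * jt_norm x"
proof -
  have *: "jt_value F (\<lambda>t. c * x t) \<le> \<bar>c\<bar> * jt_norm x" if "F \<in> segment_families" for F
    using jt_value_le_norm[OF assms(1) that] by (simp add: jt_value_scale mult_left_mono)
  show "jt_bounded (\<lambda>t. c * x t)" "jt_norm (\<lambda>t. c * x t) \<le> \<bar>c\<bar> * jt_norm x"
    using jt_boundedI[OF *] jt_norm_leI[OF *] by auto
qed

lemma jt_norm_scale:
  assumes "jt_bounded x"
  shows "jt_norm (\<lambda>t. c * x t) = \<bar>c\<bar> * jt_norm x"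
proof (cases "c = 0")
  case True
  then show ?thesis
    using jt_norm_scale_le[OF assms, of c] jt_norm_nonneg by fastforce
next
  case False
  have "jt_norm (\<lambda>t. inverse c * (c * x t)) \<le> \<bar>inverse c\<bar> * jt_norm (\<lambda>t. c * x t)"
    by (intro jt_norm_scale_le assms)
  moreover have "(\<lambda>t. inverse c * (c * x t)) = x"
    using False by (auto simp: fun_eq_iff)
  ultimately have "\<bar>c\<bar> * jt_norm x \<le> jt_norm (\<lambda>t. c * x t)"
    using False by (simp add: field_simps)
  with jt_norm_scale_le[OF assms, of c] show ?thesis by linarith
qed

lemma finitely_supported_jt_bounded:
  assumes "finitely_supported x" shows "jt_bounded x"
proof (rule jt_boundedI)
  fix F assume F: "F \<in> segment_families"
  have fin: "finite S" if "S \<in> F" for S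
    using F that is_segment_finite by (auto simp: segment_families_def)
  have "jt_value F x \<le> (\<Sum>S\<in>F. \<bar>\<Sum>t\<in>S. x t\<bar>)"
    unfolding jt_value_L2 by (rule L2_set_le_sum_abs)
  also have "\<dots> \<le> (\<Sum>S\<in>F. \<Sum>t\<in>S. \<bar>x t\<bar>)"
    by (intro sum_mono sum_abs)
  also have "\<dots> = (\<Sum>t\<in>\<Union>F. \<bar>x t\<bar>)"
    using F fin by (subst sum.Union_disjoint) (auto simp: segment_families_def pairwise_def disjnt_def)
  also have "\<dots> = (\<Sum>t\<in>\<Union>F \<inter> {t. x t \<noteq> 0}. \<bar>x t\<bar>)"
    using F fin by (intro sum.mono_neutral_right) (auto simp: segment_families_def)
  also have "\<dots> \<le> (\<Sum>t\<in>{t. x t \<noteq> 0}. \<bar>x t\<bar>)"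
    using assms by (intro sum_mono2) (auto simp: finitely_supported_def)
  finally show "jt_value F x \<le> (\<Sum>t\<in>{t. x t \<noteq> 0}. \<bar>x t\<bar>)" .
qed

lemma finitely_supported_add:
  "finitely_supported x \<Longrightarrow> finitely_supported y \<Longrightarrow> finitely_supported (\<lambda>t. x t + y t)"
  unfolding finitely_supported_def
  by (rule finite_subset[of _ "{t. x t \<noteq> 0} \<union> {t. y t \<noteq> 0}"]) auto

lemma finitely_supported_scale: "finitely_supported x \<Longrightarrow> finitely_supported (\<lambda>t. c * x t)"
  unfolding finitely_supported_def by (rule finite_subset[of _ "{t. x t \<noteq> 0}"]) auto

lemma jt_norm_zero: "jt_norm (\<lambda>t. 0) = 0"
proof -
  have "segment_families \<noteq> {}" using empty_segment_families by blast
  then show ?thesis by (simp add: jt_norm_def jt_value_def cSUP_const)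
qed

lemma finitely_supported_jt_carrier:
  assumes "finitely_supported x" shows "x \<in> jt_carrier"
  unfolding jt_carrier_def
  using assms finitely_supported_jt_bounded[OF assms] jt_norm_zero
  by (auto intro!: exI[of _ x])

lemma jt_bounded_diff:
  assumes "jt_bounded x" "jt_bounded y"
  shows "jt_bounded (\<lambda>t. x t - y t)"
  using jt_norm_add(1)[OF assms(1) jt_norm_scale_le(1)[OF assms(2), of "-1"]] by simp

lemma jt_carrier_bounded: "x \<in> jt_carrier \<Longrightarrow> jt_bounded x"
  by (simp add: jt_carrier_def)

lemma jt_carrier_add:
  assumes "x \<in> jt_carrier" "y \<in> jt_carrier"
  shows "(\<lambda>t. x t + y t) \<in> jt_carrier"
  unfolding jt_carrier_def
proof (safe)
  show "jt_bounded (\<lambda>t. x t + y t)"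
    using assms by (intro jt_norm_add jt_carrier_bounded)
  fix e :: real assume "e > 0"
  then have "e/2 > 0" by simp
  then obtain x' y' where
    x': "finitely_supported x'" "jt_norm (\<lambda>t. x t - x' t) < e/2" and
    y': "finitely_supported y'" "jt_norm (\<lambda>t. y t - y' t) < e/2"
    using assms unfolding jt_carrier_def by blast
  have "jt_norm (\<lambda>t. (x t - x' t) + (y t - y' t)) \<le>
        jt_norm (\<lambda>t. x t - x' t) + jt_norm (\<lambda>t. y t - y' t)"
    using assms x' y'
    by (intro jt_norm_add jt_bounded_diff jt_carrier_bounded finitely_supported_jt_bounded)
  then have "jt_norm (\<lambda>t. x t + y t - (x' t + y' t)) < e"
    using x' y' by (simp add: algebra_simps)
  then show "\<exists>z. finitely_supported z \<and> jt_norm (\<lambda>t. x t + y t - z t) < e"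
    using finitely_supported_add[OF x'(1) y'(1)] by blast
qed

lemma jt_carrier_scale:
  assumes "x \<in> jt_carrier"
  shows "(\<lambda>t. c * x t) \<in> jt_carrier"
  unfolding jt_carrier_def
proof (safe)
  show "jt_bounded (\<lambda>t. c * x t)"
    using assms by (intro jt_norm_scale_le jt_carrier_bounded)
  fix e :: real assume e: "e > 0"
  then have "e / (\<bar>c\<bar> + 1) > 0" by (simp add: add_nonneg_pos)
  then obtain x' where
    x': "finitely_supported x'" "jt_norm (\<lambda>t. x t - x' t) < e / (\<bar>c\<bar> + 1)"
    using assms unfolding jt_carrier_def by blast
  have b: "jt_bounded (\<lambda>t. x t - x' t)"
    using assms x' by (intro jt_bounded_diff jt_carrier_bounded finitely_supported_jt_bounded)
  have "jt_norm (\<lambda>t. c * (x t - x' t)) \<le> \<bar>c\<bar> * jt_norm (\<lambda>t. x t - x' t)"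
    by (intro jt_norm_scale_le b)
  also have "\<dots> \<le> (\<bar>c\<bar> + 1) * jt_norm (\<lambda>t. x t - x' t)"
    using jt_norm_nonneg[OF b] by (simp add: mult_right_mono)
  also have "\<dots> < e"
    using x'(2) by (simp add: pos_less_divide_eq add_nonneg_pos mult.commute)
  finally have "jt_norm (\<lambda>t. c * x t - c * x' t) < e"
    by (simp add: algebra_simps)
  then show "\<exists>z. finitely_supported z \<and> jt_norm (\<lambda>t. c * x t - z t) < e"
    using finitely_supported_scale[OF x'(1)] by blast
qed

typedef jt = jt_carrier
  morphisms jt_fun Abs_jt
  by (rule exI[of _ "\<lambda>_. 0"], rule finitely_supported_jt_carrier) (simp add: finitely_supported_def)

setup_lifting type_definition_jt

instantiation jt :: real_normed_vector
begin

lift_definition zero_jt :: jt is "\<lambda>_. 0"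
  by (rule finitely_supported_jt_carrier) (simp add: finitely_supported_def)

lift_definition plus_jt :: "jt \<Rightarrow> jt \<Rightarrow> jt" is "\<lambda>x y t. x t + y t"
  by (rule jt_carrier_add)

lift_definition minus_jt :: "jt \<Rightarrow> jt \<Rightarrow> jt" is "\<lambda>x y t. x t - y t"
  subgoal for x y
    using jt_carrier_add[of x "\<lambda>t. -1 * y t"] jt_carrier_scale[of y "-1"] by simp
  done

lift_definition uminus_jt :: "jt \<Rightarrow> jt" is "\<lambda>x t. - x t"
  subgoal for x using jt_carrier_scale[of x "-1"] by simp
  done

lift_definition scaleR_jt :: "real \<Rightarrow> jt \<Rightarrow> jt" is "\<lambda>c x t. c * x t"
  by (rule jt_carrier_scale)

lift_definition norm_jt :: "jt \<Rightarrow> real" is jt_norm .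

definition dist_jt :: "jt \<Rightarrow> jt \<Rightarrow> real" where
  "dist_jt x y = norm (x - y)"

definition sgn_jt :: "jt \<Rightarrow> jt" where
  "sgn_jt x = inverse (norm x) *\<^sub>R x"

definition uniformity_jt :: "(jt \<times> jt) filter" where
  "uniformity_jt = (INF e\<in>{0 <..}. principal {(x, y). dist x y < e})"

definition open_jt :: "jt set \<Rightarrow> bool" where
  "open_jt S = (\<forall>x\<in>S. \<forall>\<^sub>F (x', y) in uniformity. x' = x \<longrightarrow> y \<in> S)"

instance
proof
  fix x y z :: jt and a b :: real
  show "x + y + z = x + (y + z)" by transfer (simp add: add.assoc)
  show "x + y = y + x" by transfer (simp add: add.commute)
  show "0 + x = x" by transfer simp
  show "- x + x = 0" by transfer simp
  show "x - y = x + - y" by transfer simp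
  show "a *\<^sub>R (x + y) = a *\<^sub>R x + a *\<^sub>R y" by transfer (simp add: distrib_left)
  show "(a + b) *\<^sub>R x = a *\<^sub>R x + b *\<^sub>R x" by transfer (simp add: distrib_right)
  show "a *\<^sub>R b *\<^sub>R x = (a * b) *\<^sub>R x" by transfer (simp add: mult.assoc)
  show "1 *\<^sub>R x = x" by transfer simp
  show "dist x y = norm (x - y)" by (rule dist_jt_def)
  show "sgn x = inverse (norm x) *\<^sub>R x" by (rule sgn_jt_def)
  show "(uniformity :: (jt \<times> jt) filter) = (INF e\<in>{0 <..}. principal {(x, y). dist x y < e})"
    by (rule uniformity_jt_def)
  show "open U \<longleftrightarrow> (\<forall>x\<in>U. \<forall>\<^sub>F (x', y) in uniformity. x' = x \<longrightarrow> y \<in> U)" for U :: "jt set"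
    by (rule open_jt_def)
  show "norm x = 0 \<longleftrightarrow> x = 0"
  proof (transfer, safe)
    fix x assume "x \<in> jt_carrier" "jt_norm x = 0"
    then show "x = (\<lambda>_. 0)"
      using jt_abs_le_norm[OF jt_carrier_bounded, of x] by (simp add: fun_eq_iff)
  qed (rule jt_norm_zero)
  show "norm (x + y) \<le> norm x + norm y"
    by transfer (intro jt_norm_add jt_carrier_bounded)
  show "norm (a *\<^sub>R x) = \<bar>a\<bar> * norm x"
    by transfer (intro jt_norm_scale jt_carrier_bounded)
qed

end

lemma jt_fun_bounded: "jt_bounded (jt_fun x)"
  using jt_fun jt_carrier_bounded by blast

lemma abs_jt_fun_le_norm: "\<bar>jt_fun x t\<bar> \<le> norm x"
  by (simp add: norm_jt.rep_eq jt_abs_le_norm jt_fun_bounded)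

instance jt :: banach
proof
  fix X :: "nat \<Rightarrow> jt" assume X: "Cauchy X"
  have "Cauchy (\<lambda>n. jt_fun (X n) t)" for t
  proof (rule metric_CauchyI)
    fix e :: real assume "e > 0"
    from metric_CauchyD[OF X this] obtain M where
      M: "\<And>m n. m \<ge> M \<Longrightarrow> n \<ge> M \<Longrightarrow> dist (X m) (X n) < e" by blast
    have "dist (jt_fun (X m) t) (jt_fun (X n) t) < e" if "m \<ge> M" "n \<ge> M" for m n
      using M[OF that] abs_jt_fun_le_norm[of "X m - X n" t]
      by (simp add: dist_real_def dist_norm minus_jt.rep_eq)
    then show "\<exists>M. \<forall>m\<ge>M. \<forall>n\<ge>M. dist (jt_fun (X m) t) (jt_fun (X n) t) < e" by blast
  qed
  then have "\<exists>l. (\<lambda>n. jt_fun (X n) t) \<longlonglongrightarrow> l" for t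
    by (simp add: Cauchy_convergent_iff convergent_def)
  then obtain l where l: "\<And>t. (\<lambda>n. jt_fun (X n) t) \<longlonglongrightarrow> l t" by metis
  have close: "\<exists>M. \<forall>n\<ge>M. \<forall>F\<in>segment_families. jt_value F (\<lambda>t. jt_fun (X n) t - l t) \<le> e"
    if "e > 0" for e
  proof -
    from metric_CauchyD[OF X that] obtain M where
      M: "\<And>m n. m \<ge> M \<Longrightarrow> n \<ge> M \<Longrightarrow> dist (X m) (X n) < e" by blast
    have "jt_value F (\<lambda>t. jt_fun (X n) t - l t) \<le> e" if "n \<ge> M" "F \<in> segment_families" for n F
    proof (rule tendsto_upperbound)
      show "(\<lambda>m. jt_value F (\<lambda>t. jt_fun (X n) t - jt_fun (X m) t))
              \<longlonglongrightarrow> jt_value F (\<lambda>t. jt_fun (X n) t - l t)"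
        unfolding jt_value_def by (intro tendsto_intros l)
      show "\<forall>\<^sub>F m in sequentially. jt_value F (\<lambda>t. jt_fun (X n) t - jt_fun (X m) t) \<le> e"
        using eventually_ge_at_top[of M]
      proof eventually_elim
        case (elim m)
        have "jt_value F (jt_fun (X n - X m)) \<le> norm (X n - X m)"
          unfolding norm_jt.rep_eq by (intro jt_value_le_norm jt_fun_bounded that)
        with M[OF that(1) elim] show ?case by (simp add: dist_norm minus_jt.rep_eq)
      qed
    qed simp
    then show ?thesis by blast
  qed
  obtain N where N: "\<forall>F\<in>segment_families. jt_value F (\<lambda>t. jt_fun (X N) t - l t) \<le> 1"
    using close[of 1] by auto
  then have "jt_bounded (\<lambda>t. jt_fun (X N) t - l t)"
    by (intro jt_boundedI) auto
  from jt_bounded_diff[OF jt_fun_bounded[of "X N"] this] have lb: "jt_bounded l"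
    by simp
  have "l \<in> jt_carrier"
    unfolding jt_carrier_def
  proof safe
    fix e :: real assume e: "e > 0"
    obtain n where n: "\<forall>F\<in>segment_families. jt_value F (\<lambda>t. jt_fun (X n) t - l t) \<le> e/2"
      using close[of "e/2"] e by auto
    obtain y where y: "finitely_supported y" "jt_norm (\<lambda>t. jt_fun (X n) t - y t) < e/2"
      using jt_fun[of "X n"] e half_gt_zero unfolding jt_carrier_def by blast
    have b: "jt_bounded (\<lambda>t. jt_fun (X n) t - l t)"
      by (intro jt_bounded_diff jt_fun_bounded lb)
    have "jt_norm (\<lambda>t. (jt_fun (X n) t - y t) + -1 * (jt_fun (X n) t - l t)) \<le>
          jt_norm (\<lambda>t. jt_fun (X n) t - y t) + jt_norm (\<lambda>t. -1 * (jt_fun (X n) t - l t))"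
      by (intro jt_norm_add jt_norm_scale_le jt_bounded_diff jt_fun_bounded lb
          finitely_supported_jt_bounded y)
    also have "jt_norm (\<lambda>t. -1 * (jt_fun (X n) t - l t)) = jt_norm (\<lambda>t. jt_fun (X n) t - l t)"
      using jt_norm_scale[OF b, of "-1"] by simp
    also have "\<dots> \<le> e/2"
      using n by (intro jt_norm_leI) auto
    finally have "jt_norm (\<lambda>t. l t - y t) < e"
      using y(2) by simp
    with y(1) show "\<exists>y. finitely_supported y \<and> jt_norm (\<lambda>t. l t - y t) < e" by blast
  qed (rule lb)
  then have L: "jt_fun (Abs_jt l) = l" by (simp add: Abs_jt_inverse)
  have "X \<longlonglongrightarrow> Abs_jt l"
  proof (rule metric_LIMSEQ_I)
    fix e :: real assume e: "e > 0"
    obtain M where M: "\<forall>n\<ge>M. \<forall>F\<in>segment_families. jt_value F (\<lambda>t. jt_fun (X n) t - l t) \<le> e/2"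
      using close[of "e/2"] e by auto
    have "dist (X n) (Abs_jt l) < e" if "n \<ge> M" for n
    proof -
      have "jt_norm (\<lambda>t. jt_fun (X n) t - l t) \<le> e/2"
        using M that by (intro jt_norm_leI) auto
      with e show ?thesis by (simp add: dist_norm norm_jt.rep_eq minus_jt.rep_eq L)
    qed
    then show "\<exists>M. \<forall>n\<ge>M. dist (X n) (Abs_jt l) < e" by blast
  qed
  then show "convergent X" by (auto simp: convergent_def)
qed

lift_definition jt_basis :: "node \<Rightarrow> jt" is "\<lambda>t s. if s = t then 1 else 0"
  by (rule finitely_supported_jt_carrier) (simp add: finitely_supported_def)

lift_definition jt_coord :: "node \<Rightarrow> jt \<Rightarrow>\<^sub>L real" is "\<lambda>t x. jt_fun x t"
proof (rule bounded_linear_intro)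
  show "norm (jt_fun x t) \<le> norm x * 1" for x t
    by (simp add: abs_jt_fun_le_norm)
qed (simp_all add: plus_jt.rep_eq scaleR_jt.rep_eq)

lemma jt_coord_basis: "blinfun_apply (jt_coord t) (jt_basis s) = (if s = t then 1 else 0)"
  by (auto simp: jt_coord.rep_eq jt_basis.rep_eq)

lemma jt_fun_sum: "jt_fun (\<Sum>i\<in>I. f i) t = (\<Sum>i\<in>I. jt_fun (f i) t)"
  by (induction I rule: infinite_finite_induct) (simp_all add: zero_jt.rep_eq plus_jt.rep_eq)

lemma closure_span_jt_basis: "closure (span (range jt_basis)) = UNIV"
proof -
  have "x \<in> closure (span (range jt_basis))" for x
    unfolding closure_approachable
  proof (intro allI impI)
    fix e :: real assume "e > 0"
    then obtain y where y: "finitely_supported y" "jt_norm (\<lambda>t. jt_fun x t - y t) < e"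
      using jt_fun[of x] unfolding jt_carrier_def by blast
    have fin: "finite {t. y t \<noteq> 0}" using y(1) by (simp add: finitely_supported_def)
    define z where "z = (\<Sum>t\<in>{t. y t \<noteq> 0}. y t *\<^sub>R jt_basis t)"
    have "jt_fun z = y"
      using fin by (auto simp: z_def jt_fun_sum scaleR_jt.rep_eq jt_basis.rep_eq fun_eq_iff
          if_distrib sum.delta' cong: if_cong)
    then have "dist z x < e"
      using y(2) by (subst dist_commute) (simp add: dist_norm norm_jt.rep_eq minus_jt.rep_eq)
    moreover have "z \<in> span (range jt_basis)"
      unfolding z_def by (intro span_sum span_scale span_base) auto
    ultimately show "\<exists>z\<in>span (range jt_basis). dist z x < e" by blast
  qed
  then show ?thesis by auto
qed


section \<open>The predual of the James tree space\<close>

typedef jt_predual = "closure (span (range jt_coord)) :: (jt \<Rightarrow>\<^sub>L real) set"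
  morphisms predual_functional Abs_jt_predual
  by (rule exI[of _ 0], rule subsetD[OF closure_subset]) (rule span_zero)

setup_lifting type_definition_jt_predual

lemma closure_span_closed:
  fixes S :: "'a::real_normed_vector set"
  shows "0 \<in> closure (span S)"
    and "x \<in> closure (span S) \<Longrightarrow> y \<in> closure (span S) \<Longrightarrow> x + y \<in> closure (span S)"
    and "x \<in> closure (span S) \<Longrightarrow> c *\<^sub>R x \<in> closure (span S)"
proof -
  show "0 \<in> closure (span S)"
    by (rule subsetD[OF closure_subset]) (rule span_zero)
  show "x + y \<in> closure (span S)" if "x \<in> closure (span S)" "y \<in> closure (span S)"
    using that unfolding closure_sequential by (metis (no_types, lifting) span_add tendsto_add)
  show "c *\<^sub>R x \<in> closure (span S)" if "x \<in> closure (span S)"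
    using that unfolding closure_sequential
    by (metis (no_types, lifting) span_scale tendsto_scaleR tendsto_const)
qed

instantiation jt_predual :: real_normed_vector
begin

lift_definition zero_jt_predual :: jt_predual is 0
  by (rule closure_span_closed)

lift_definition plus_jt_predual :: "jt_predual \<Rightarrow> jt_predual \<Rightarrow> jt_predual" is "(+)"
  by (rule closure_span_closed)

lift_definition minus_jt_predual :: "jt_predual \<Rightarrow> jt_predual \<Rightarrow> jt_predual" is "(-)"
  subgoal for x y
    using closure_span_closed(2)[of x _ "-1 *\<^sub>R y"] closure_span_closed(3)[of y _ "-1"] by simp
  done

lift_definition uminus_jt_predual :: "jt_predual \<Rightarrow> jt_predual" is uminus
  subgoal for x using closure_span_closed(3)[of x _ "-1"] by simp
  done

lift_definition scaleR_jt_predual :: "real \<Rightarrow> jt_predual \<Rightarrow> jt_predual" is "(*\<^sub>R)"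
  by (rule closure_span_closed)

lift_definition norm_jt_predual :: "jt_predual \<Rightarrow> real" is norm .

definition dist_jt_predual :: "jt_predual \<Rightarrow> jt_predual \<Rightarrow> real" where
  "dist_jt_predual x y = norm (x - y)"

definition sgn_jt_predual :: "jt_predual \<Rightarrow> jt_predual" where
  "sgn_jt_predual x = inverse (norm x) *\<^sub>R x"

definition uniformity_jt_predual :: "(jt_predual \<times> jt_predual) filter" where
  "uniformity_jt_predual = (INF e\<in>{0 <..}. principal {(x, y). dist x y < e})"

definition open_jt_predual :: "jt_predual set \<Rightarrow> bool" where
  "open_jt_predual S = (\<forall>x\<in>S. \<forall>\<^sub>F (x', y) in uniformity. x' = x \<longrightarrow> y \<in> S)"

instance
proof
  fix x y z :: jt_predual and a b :: real
  show "x + y + z = x + (y + z)" by transfer (simp add: add.assoc)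
  show "x + y = y + x" by transfer (simp add: add.commute)
  show "0 + x = x" by transfer simp
  show "- x + x = 0" by transfer simp
  show "x - y = x + - y" by transfer simp
  show "a *\<^sub>R (x + y) = a *\<^sub>R x + a *\<^sub>R y" by transfer (simp add: scaleR_add_right)
  show "(a + b) *\<^sub>R x = a *\<^sub>R x + b *\<^sub>R x" by transfer (simp add: scaleR_add_left)
  show "a *\<^sub>R b *\<^sub>R x = (a * b) *\<^sub>R x" by transfer simp
  show "1 *\<^sub>R x = x" by transfer simp
  show "dist x y = norm (x - y)" by (rule dist_jt_predual_def)
  show "sgn x = inverse (norm x) *\<^sub>R x" by (rule sgn_jt_predual_def)
  show "(uniformity :: (jt_predual \<times> jt_predual) filter) =
          (INF e\<in>{0 <..}. principal {(x, y). dist x y < e})"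
    by (rule uniformity_jt_predual_def)
  show "open U \<longleftrightarrow> (\<forall>x\<in>U. \<forall>\<^sub>F (x', y) in uniformity. x' = x \<longrightarrow> y \<in> U)" for U :: "jt_predual set"
    by (rule open_jt_predual_def)
  show "norm x = 0 \<longleftrightarrow> x = 0" by transfer simp
  show "norm (x + y) \<le> norm x + norm y" by transfer (rule norm_triangle_ineq)
  show "norm (a *\<^sub>R x) = \<bar>a\<bar> * norm x" by transfer simp
qed

end

lemma dist_predual_functional:
  "dist (predual_functional x) (predual_functional y) = dist x y"
  by (simp add: dist_norm norm_jt_predual.rep_eq minus_jt_predual.rep_eq)

instance jt_predual :: banach
proof
  fix X :: "nat \<Rightarrow> jt_predual" assume "Cauchy X"
  then have "Cauchy (\<lambda>n. predual_functional (X n))"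
    by (simp add: Cauchy_def dist_predual_functional)
  then obtain l where l: "(\<lambda>n. predual_functional (X n)) \<longlonglongrightarrow> l"
    by (auto simp: Cauchy_convergent_iff convergent_def)
  have "l \<in> closure (span (range jt_coord))"
    using closed_sequentially[OF closed_closure _ l] predual_functional by blast
  then have "l = predual_functional (Abs_jt_predual l)"
    by (simp add: Abs_jt_predual_inverse)
  with l have "X \<longlonglongrightarrow> Abs_jt_predual l"
    by (metis (no_types, lifting) dist_predual_functional lim_sequentially)
  then show "convergent X" by (auto simp: convergent_def)
qed

lemma predual_functional_sum:
  "predual_functional (\<Sum>i\<in>I. f i) = (\<Sum>i\<in>I. predual_functional (f i))"
  by (induction I rule: infinite_finite_induct)
    (simp_all add: zero_jt_predual.rep_eq plus_jt_predual.rep_eq)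

instance jt_predual :: infinite_dimensional_banach
proof
  fix B :: "jt_predual set" assume B: "finite B"
  show "\<exists>x. \<forall>u. x \<noteq> (\<Sum>b\<in>B. u b *\<^sub>R b)"
  proof (rule ccontr)
    assume "\<not> ?thesis"
    then have all: "\<And>x. \<exists>u. x = (\<Sum>b\<in>B. u b *\<^sub>R b)" by blast
    have mem: "jt_coord t \<in> span (predual_functional ` B)" for t
    proof -
      have "jt_coord t \<in> closure (span (range jt_coord))"
        by (intro subsetD[OF closure_subset] span_base) simp
      then have "jt_coord t = predual_functional (Abs_jt_predual (jt_coord t))"
        by (simp add: Abs_jt_predual_inverse)
      moreover obtain u where "Abs_jt_predual (jt_coord t) = (\<Sum>b\<in>B. u b *\<^sub>R b)"
        using all by blast
      ultimately have "jt_coord t = (\<Sum>b\<in>B. u b *\<^sub>R predual_functional b)"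
        by (simp add: predual_functional_sum scaleR_jt_predual.rep_eq)
      then show ?thesis
        by (simp only:) (intro span_sum span_scale span_base imageI)
    qed
    have inj: "inj jt_coord"
    proof (rule injI)
      fix s t assume "jt_coord s = jt_coord t"
      then have "blinfun_apply (jt_coord s) (jt_basis s) = blinfun_apply (jt_coord t) (jt_basis s)"
        by simp
      then show "s = t" by (auto simp: jt_coord_basis split: if_splits)
    qed
    have "independent (range jt_coord)"
      unfolding independent_explicit_module
    proof (intro allI impI)
      fix T u v
      assume T: "finite T" "T \<subseteq> range jt_coord" "(\<Sum>v\<in>T. u v *\<^sub>R v) = 0" "v \<in> T"
      then obtain t where t: "v = jt_coord t" by auto
      have "0 = blinfun_apply (\<Sum>v\<in>T. u v *\<^sub>R v) (jt_basis t)"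
        using T(3) by simp
      also have "\<dots> = (\<Sum>v\<in>T. u v * blinfun_apply v (jt_basis t))"
        by (simp add: blinfun.sum_left blinfun.scaleR_left)
      also have "\<dots> = (\<Sum>w\<in>T. if w = v then u v else 0)"
        using T(2) inj by (intro sum.cong) (auto simp: t jt_coord_basis inj_eq)
      also have "\<dots> = u v" using T by simp
      finally show "u v = 0" by simp
    qed
    then have "finite (range jt_coord)"
      using independent_span_bound[of "predual_functional ` B" "range jt_coord"] B mem by auto
    then have "finite (UNIV :: node set)" using finite_imageD inj by blast
    then show False by (simp add: infinite_UNIV_listI)
  qed
qed

end

theory Submission
  imports Defs
begin

text \<open>Norms in the predual are bounded from below by evaluation at vectors of \<open>JT\<close>. Let \<open>x\<close> be a norm one functional in the
  predual. Up to a small error it is supported on the levels \<open>0, \<dots>, N - 1\<close> for some \<open>N\<close>, and it is almost normed by a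
  vector \<open>u\<close> of the unit ball that lives on these levels. For the subspace of finite codimension
  take all \<open>y\<close> that vanish on the levels up to \<open>N\<close>; such a \<open>y\<close> of norm one is almost normed by a
  vector \<open>v\<close> of the unit ball that lives beyond level \<open>N\<close>. If the norm of \<open>u + \<beta> v\<close> were at most
  \<open>1 + C \<beta>\<^sup>2\<close>, then evaluating \<open>x + \<epsilon> y\<close> there would give a norm of at least about
  \<open>(1 + \<epsilon> \<beta>) / (1 + C \<beta>\<^sup>2)\<close>, hence a gain of order \<open>\<epsilon>\<^sup>2\<close> for \<open>\<beta>\<close> proportional to \<open>\<epsilon>\<close>.

  That norm bound fails in general, because a segment may pass from the support of \<open>u\<close> to that of \<open>v\<close>
  and collect sums of equal sign from both. But neither \<open>x\<close> nor \<open>y\<close> sees level \<open>N\<close>, so any vector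
  \<open>w\<close> on that level may be added for free. It is used to steer the signs (lemma \<open>gap_correction\<close>): choosing
  \<open>w\<close> at a node \<open>p\<close> at least as large as all segment sums of \<open>v\<close> below \<open>p\<close> fixes the sign of every
  \<open>(w + v)\<close>-sum along a segment through \<open>p\<close>, and this sign \<open>\<sigma> p\<close> is at our disposal. Segments on which the sum of
  \<open>u\<close> has the opposite sign do no harm. Those on which it has the same sign must be harmless for another reason,
  and \<open>crossing_sign\<close> shows that one of the two signs achieves this. Indeed, suppose that two paths ending at
  \<open>p\<close> carry sums of \<open>u\<close> of opposite signs, say \<open>a > 0\<close> on the longer and \<open>- c < 0\<close> on the shorter one. Cutting the longer
  path where the shorter one starts raises its square sum from \<open>a\<^sup>2\<close> to \<open>(a + c)\<^sup>2 + c\<^sup>2\<close>. So if \<open>c\<close>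
  is at least of order \<open>\<beta>\<close>, then the norm bound for \<open>u\<close> leaves enough room on the longer path to absorb the cross
  term \<open>2 \<beta> a z\<close>, where \<open>z\<close> is the \<open>(w + v)\<close>-sum; and if \<open>c\<close> is smaller, then the cross term on the
  shorter path is itself of order \<open>\<beta>\<^sup>2\<close> (lemma \<open>crossing_estimate\<close>).

  This yields the modulus bound \<open>\<epsilon>\<^sup>2 / 200\<close>, which dominates \<open>\<epsilon>\<^sup>3 / 200\<close> on the unit interval.\<close>

section \<open>Segments as prefix intervals\<close>

definition tree_path :: "node \<Rightarrow> node \<Rightarrow> node set" where
  "tree_path p q = {s. prefix p s \<and> prefix s q}"

lemma finite_tree_path: "finite (tree_path p q)"
  by (rule finite_subset[of _ "set (prefixes q)"]) (auto simp: tree_path_def)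

lemma is_segment_tree_path:
  assumes "prefix p q" shows "is_segment (tree_path p q)"
  unfolding is_segment_def
proof (intro exI conjI)
  let ?I = "{length p..length p + (length q - length p)}"
  have len: "length p \<le> length q" using assms by (rule prefix_length_le)
  have "s \<in> (\<lambda>i. take i q) ` ?I" if "s \<in> tree_path p q" for s
  proof (rule image_eqI[of _ _ "length s"])
    show "s = take (length s) q"
      using that by (auto simp: tree_path_def prefix_def)
    show "length s \<in> ?I"
      using that prefix_length_le[of p s] prefix_length_le[of s q] len by (auto simp: tree_path_def)
  qed
  moreover have "take i q \<in> tree_path p q" if "i \<in> ?I" for i
  proof -
    have "take (length p) (take i q) = p"
      using that assms by (auto simp: prefix_def min_def)
    then show ?thesis using take_is_prefix[of "length p" "take i q"]
      by (simp add: tree_path_def take_is_prefix)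
  qed
  ultimately show "tree_path p q = (\<lambda>i. take i q) ` ?I" by blast
  show "\<forall>i\<in>?I. length (take i q) = i" using len by auto
  show "\<forall>i\<in>?I. \<forall>j\<in>?I. prefix (take i q) (take j q) \<or> prefix (take j q) (take i q)"
    using prefix_same_cases take_is_prefix by blast
qed

text \<open>Two members of a segment with comparable lengths are comparable as prefixes, so a segment is
  recovered from its first and last node. Working with endpoints makes it easy to cut segments
  at a level or at a node.\<close>

lemma is_segment_imp_tree_path:
  assumes "is_segment S" obtains p q where "prefix p q" "S = tree_path p q"
proof -
  obtain n k and t :: "nat \<Rightarrow> node" where S: "S = t ` {n..n+k}"
    and len: "\<And>i. i \<in> {n..n+k} \<Longrightarrow> length (t i) = i"
    and lin: "\<And>i j. i \<in> {n..n+k} \<Longrightarrow> j \<in> {n..n+k} \<Longrightarrow> prefix (t i) (t j) \<or> prefix (t j) (t i)"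
    using assms unfolding is_segment_def by blast
  have mono: "prefix (t i) (t j)" if "i \<in> {n..n+k}" "j \<in> {n..n+k}" "i \<le> j" for i j
    using lin[OF that(1,2)]
  proof
    assume "prefix (t j) (t i)"
    then have "t i = t j"
      using that len prefix_length_prefix[of "t i" "t i" "t j"]
      by (metis le_antisym prefix_length_le prefix_def append_Nil2 append_eq_append_conv)
    then show ?thesis by simp
  qed
  have "s \<in> S" if "prefix (t n) s" "prefix s (t (n+k))" for s
  proof -
    have l: "length s \<in> {n..n+k}"
      using that[THEN prefix_length_le] len[of n] len[of "n+k"] by auto
    have "prefix (t (length s)) (t (n+k))" using l by (intro mono) auto
    then have "s = t (length s)"
      using that(2) len[OF l] by (metis prefix_def append_eq_append_conv)
    then show ?thesis using l S by blast
  qed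
  then have "S = tree_path (t n) (t (n+k))"
    using mono unfolding S tree_path_def by fastforce
  moreover have "prefix (t n) (t (n+k))" by (rule mono) auto
  ultimately show thesis using that by blast
qed

text \<open>The form in which the norm is used below: families are indexed and may contain empty members,
  so that cutting each segment of a family into pieces, some of them possibly empty, again gives
  an admissible family.\<close>

lemma sum_squares_le_jt_norm:
  assumes x: "jt_bounded x" and I: "finite I" and dis: "disjoint_family_on A I"
    and A: "\<And>i. i \<in> I \<Longrightarrow> A i = {} \<or> is_segment (A i)"
  shows "(\<Sum>i\<in>I. (\<Sum>t\<in>A i. x t)\<^sup>2) \<le> (jt_norm x)\<^sup>2"
proof -
  define J where "J = {i\<in>I. A i \<noteq> {}}"
  have inj: "inj_on A J"
    using dis by (fastforce simp: inj_on_def J_def disjoint_family_on_def)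
  have "A ` J \<in> segment_families"
    using I A dis
    by (fastforce simp: segment_families_def J_def pairwise_def disjnt_def disjoint_family_on_def)
  from jt_value_le_norm[OF x this]
  have "sqrt (\<Sum>i\<in>J. (\<Sum>t\<in>A i. x t)\<^sup>2) \<le> jt_norm x"
    by (simp add: jt_value_def sum.reindex[OF inj] o_def)
  then have "(\<Sum>i\<in>J. (\<Sum>t\<in>A i. x t)\<^sup>2) \<le> (jt_norm x)\<^sup>2"
    by (rule sqrt_le_D)
  moreover have "(\<Sum>i\<in>J. (\<Sum>t\<in>A i. x t)\<^sup>2) = (\<Sum>i\<in>I. (\<Sum>t\<in>A i. x t)\<^sup>2)"
    using I by (intro sum.mono_neutral_left) (auto simp: J_def)
  ultimately show ?thesis by simp
qed

text \<open>The supremum of the segment sums inside \<open>Q\<close> is nearly attained. The loss is a factor rather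
  than an additive error, so that bounds obtained in this way for many disjoint sets \<open>Q\<close> remain
  square summable, with a sum controlled by the norm of \<open>v\<close>.\<close>

lemma near_maximal_segment:
  assumes v: "jt_bounded v"
  obtains A where "A = {} \<or> is_segment A" "A \<subseteq> Q"
    "\<And>S. is_segment S \<Longrightarrow> S \<subseteq> Q \<Longrightarrow> \<bar>\<Sum>t\<in>S. v t\<bar> \<le> 2 * \<bar>\<Sum>t\<in>A. v t\<bar>"
proof -
  define X where "X = {\<bar>\<Sum>t\<in>S. v t\<bar> | S. is_segment S \<and> S \<subseteq> Q}"
  have "\<bar>\<Sum>t\<in>S. v t\<bar> \<le> jt_norm v" if "is_segment S" for S
    using sum_squares_le_jt_norm[OF v, of "{S}" id] that jt_norm_nonneg[OF v]
      abs_le_square_iff[of "\<Sum>t\<in>S. v t" "jt_norm v"]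
    by (auto simp: disjoint_family_on_def)
  then have bdd: "bdd_above X" by (auto simp: X_def intro!: bdd_aboveI[of _ "jt_norm v"])
  show thesis
  proof (cases "\<exists>a\<in>X. a > 0")
    case True
    then obtain a where a: "a \<in> X" "a > 0" by blast
    then have "Sup X > 0" using cSup_upper[OF a(1) bdd] by simp
    then have "Sup X / 2 < Sup X" by simp
    then obtain b where b: "b \<in> X" "Sup X / 2 < b"
      using less_cSupE[of "Sup X / 2" X] a by auto
    then obtain A where A: "is_segment A" "A \<subseteq> Q" "b = \<bar>\<Sum>t\<in>A. v t\<bar>" by (auto simp: X_def)
    have "\<bar>\<Sum>t\<in>S. v t\<bar> \<le> 2 * \<bar>\<Sum>t\<in>A. v t\<bar>" if "is_segment S" "S \<subseteq> Q" for S
    proof -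
      have "\<bar>\<Sum>t\<in>S. v t\<bar> \<le> Sup X" using that bdd by (intro cSup_upper) (auto simp: X_def)
      then show ?thesis using b A by simp
    qed
    then show thesis using that A by blast
  next
    case False
    then have "\<bar>\<Sum>t\<in>S. v t\<bar> \<le> 0" if "is_segment S" "S \<subseteq> Q" for S
      using that unfolding X_def by force
    then show thesis using that[of "{}"] by simp
  qed
qed

section \<open>Joining a low and a high vector across a level\<close>

text \<open>Read \<open>a j\<close> as the sum of \<open>u\<close> over the path from \<open>j\<close> to \<open>p\<close>. For one of the two signs, every
  large sum of that sign starts above a start of a sum of the other sign that is at least as
  large as the threshold. If both signs failed, take a failing start for each: the deeper of the
  two is just the witness that the other one lacks.\<close>

lemma crossing_sign:
  fixes a :: "node \<Rightarrow> real"
  assumes "c \<ge> 0"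
  shows "\<exists>\<sigma>\<in>{1,-1::real}. \<forall>j. prefix j p \<longrightarrow> \<sigma> * a j > c \<longrightarrow>
     (\<exists>k. strict_prefix j k \<and> prefix k p \<and> \<sigma> * a k \<le> - c)"
proof (rule ccontr)
  assume "\<not> ?thesis"
  then obtain i j where i: "prefix i p" "a i > c"
     "\<And>k. strict_prefix i k \<Longrightarrow> prefix k p \<Longrightarrow> \<not> a k \<le> - c"
   and j: "prefix j p" "- a j > c"
     "\<And>k. strict_prefix j k \<Longrightarrow> prefix k p \<Longrightarrow> \<not> - a k \<le> - c"
    by auto
  have "strict_prefix i j \<or> strict_prefix j i \<or> i = j"
    using prefix_same_cases[OF i(1) j(1)] by (auto simp: strict_prefix_def)
  then show False using i j assms by force
qed

text \<open>\<open>butlast k\<close> is the parent of \<open>k\<close>.\<close>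

lemma split_tree_path:
  assumes "strict_prefix j k" "prefix k p"
  shows "tree_path j p = tree_path j (butlast k) \<union> tree_path k p" "tree_path j (butlast k) \<inter> tree_path k p = {}"
    "prefix j (butlast k)"
proof -
  have k: "k \<noteq> []" using assms by auto
  have b: "prefix s (butlast k) \<longleftrightarrow> strict_prefix s k" for s
  proof -
    have "strict_prefix s (butlast k @ [last k]) \<longleftrightarrow> prefix s (butlast k)"
      by (auto simp: strict_prefix_def dest: prefix_length_le)
    then show ?thesis using k by simp
  qed
  show "prefix j (butlast k)" using assms b by simp
  have "strict_prefix s k \<or> prefix k s" if "prefix s p" for s
    using that assms(2) prefix_same_cases by (metis prefix_order.le_less)
  then show "tree_path j p = tree_path j (butlast k) \<union> tree_path k p"
    using assms prefix_order.trans[of j k] prefix_order.trans[of _ k p]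
      prefix_order.less_imp_le[of j k] prefix_order.less_imp_le[of _ k]
    unfolding tree_path_def b by blast
  show "tree_path j (butlast k) \<inter> tree_path k p = {}"
    using prefix_order.less_le_not_le unfolding tree_path_def b by auto
qed

text \<open>Here \<open>u\<close> lives above level \<open>N\<close>, \<open>v\<close> below it and \<open>w\<close> on it. Only a segment through a node \<open>p\<close>
  of level \<open>N\<close> sees both \<open>u\<close> and \<open>w + v\<close>. Let \<open>a\<close> be its \<open>u\<close>-sum and \<open>z\<close> its \<open>(w + v)\<close>-sum; by the
  choice of \<open>w\<close> the sign of \<open>z\<close> is \<open>\<sigma> p\<close>, unless \<open>z = 0\<close>, and \<open>\<bar>z\<bar> \<le> 2 m p\<close>. The danger is the cross term \<open>2 \<beta> a z\<close>, which is
  only of first order in \<open>\<beta>\<close>. It is harmless in each of three cases: if \<open>a\<close> has the sign opposite to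
  \<open>\<sigma> p\<close>, the term is nonpositive; if \<open>\<bar>a\<bar> \<le> 2 \<beta> m p\<close>, it is of second order; otherwise the hypothesis on
  \<open>\<sigma>\<close> provides a point where the \<open>u\<close>-part of the segment can be cut into \<open>A\<close> and \<open>B\<close>, and the two
  pieces carry enough additional square sum to pay for the cross term. The constant 10 adds the 8 from the
  second case to the 2 from \<open>z\<^sup>2 \<le> 2 (m p)\<^sup>2 + 2 b\<^sup>2\<close>, where \<open>b\<close> is the \<open>v\<close>-sum.\<close>

lemma crossing_estimate:
  fixes u v w m :: "node \<Rightarrow> real"
  assumes u: "\<And>t. length t \<ge> N \<Longrightarrow> u t = 0"
    and v: "\<And>t. length t \<le> N \<Longrightarrow> v t = 0"
    and w: "\<And>t. w t = (if length t = N then \<sigma> t * m t else 0)"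
    and m: "\<And>p. m p \<ge> 0" and \<beta>: "\<beta> \<ge> 0"
    and below: "\<And>p S. is_segment S \<Longrightarrow> S \<subseteq> {t. strict_prefix p t} \<Longrightarrow> \<bar>\<Sum>t\<in>S. v t\<bar> \<le> m p"
    and \<sigma>: "\<And>p. \<sigma> p \<in> {1, -1}"
    and sgn: "\<And>j p. prefix j p \<Longrightarrow> \<sigma> p * (\<Sum>t\<in>tree_path j p. u t) > 2 * \<beta> * m p \<Longrightarrow>
      \<exists>k. strict_prefix j k \<and> prefix k p \<and> \<sigma> p * (\<Sum>t\<in>tree_path k p. u t) \<le> - (2 * \<beta> * m p)"
    and S: "is_segment S"
  shows "\<exists>A B. A \<union> B \<subseteq> S \<and> A \<inter> B = {} \<and> (A = {} \<or> is_segment A) \<and> (B = {} \<or> is_segment B) \<and>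
    (\<Sum>t\<in>S. u t + \<beta> * (w t + v t))\<^sup>2 \<le> (\<Sum>t\<in>A. u t)\<^sup>2 + (\<Sum>t\<in>B. u t)\<^sup>2
       + 10 * \<beta>\<^sup>2 * (\<Sum>p\<in>S \<inter> {p. length p = N}. (m p)\<^sup>2) + 2 * \<beta>\<^sup>2 * (\<Sum>t\<in>S. v t)\<^sup>2"
proof -
  obtain j q where jq: "prefix j q" "S = tree_path j q"
    using is_segment_imp_tree_path[OF S] by blast
  have fin: "finite S" using jq finite_tree_path by simp
  have len: "length j \<le> length t" "length t \<le> length q" if "t \<in> S" for t
    using that prefix_length_le unfolding jq tree_path_def by auto
  have sum: "(\<Sum>t\<in>S. u t + \<beta> * (w t + v t))
      = (\<Sum>t\<in>S. u t) + \<beta> * ((\<Sum>t\<in>S. w t) + (\<Sum>t\<in>S. v t))"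
    by (simp add: sum.distrib sum_distrib_left algebra_simps)
  consider "length q < N" | "length j > N" | "length j \<le> N" "N \<le> length q" by linarith
  then show ?thesis
  proof cases
    case 1
    then have "(\<Sum>t\<in>S. w t) = 0" "(\<Sum>t\<in>S. v t) = 0" and "S \<inter> {p. length p = N} = {}"
      using len by (force intro!: sum.neutral simp: w v)+
    then show ?thesis unfolding sum using S by (intro exI[of _ S] exI[of _ "{}"]) simp
  next
    case 2
    then have "(\<Sum>t\<in>S. w t) = 0" "(\<Sum>t\<in>S. u t) = 0" and "S \<inter> {p. length p = N} = {}"
      using len by (force intro!: sum.neutral simp: w u)+
    then show ?thesis unfolding sum
      by (intro exI[of _ "{}"]) (simp add: power_mult_distrib)
  next
    case 3
    define p where "p = take N q"
    have lp: "length p = N" and pq: "prefix p q" using 3 by (auto simp: p_def take_is_prefix)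
    have jp: "prefix j p" using prefix_length_prefix[OF jq(1) pq] lp 3 by simp
    have "t = p" if "length t = N" "t \<in> S" for t
      using that by (auto simp: jq tree_path_def p_def prefix_def)
    moreover have "p \<in> S" using jp pq by (simp add: jq tree_path_def)
    ultimately have Sp: "S \<inter> {p. length p = N} = {p}" using lp by blast
    define a where "a k = (\<Sum>t\<in>tree_path k p. u t)" for k
    have sub: "tree_path j p \<subseteq> S"
      using pq prefix_order.trans by (auto simp: jq tree_path_def)
    have "u t = 0" if "t \<in> S - tree_path j p" for t
    proof (rule ccontr)
      assume "u t \<noteq> 0"
      then have "length t \<le> length p" using u[of t] lp by linarith
      moreover have "prefix t q" using that by (simp add: jq tree_path_def)
      ultimately have "prefix t p" using prefix_length_prefix pq by blast
      then show False using that unfolding jq tree_path_def by blast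
    qed
    then have us: "(\<Sum>t\<in>S. u t) = a j"
      unfolding a_def using sub fin by (intro sum.mono_neutral_right) auto
    have "(\<Sum>t\<in>S. w t) = (\<Sum>t\<in>S \<inter> {p. length p = N}. w t)"
      using fin by (intro sum.mono_neutral_right) (auto simp: w)
    then have ws: "(\<Sum>t\<in>S. w t) = \<sigma> p * m p" unfolding Sp using lp by (simp add: w)
    define b where "b = (\<Sum>t\<in>S. v t)"
    have b: "\<bar>b\<bar> \<le> m p"
    \<comment> \<open>If \<open>q = p\<close>, the segment ends at level \<open>N\<close>; otherwise its part below \<open>p\<close> is again a segment,
      which starts at the child \<open>r\<close> of \<open>p\<close>.\<close>
    proof (cases "length q = N")
      case True
      then have "b = 0" unfolding b_def using len by (force intro!: sum.neutral v)
      then show ?thesis using m by simp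
    next
      case False
      define r where "r = take (Suc N) q"
      have rq: "prefix r q" "length r = Suc N" using 3 False by (auto simp: r_def take_is_prefix)
      have pr: "strict_prefix p r"
        using prefix_length_prefix[OF pq rq(1)] lp rq(2) by (auto simp: strict_prefix_def)
      have "prefix j r" using jp pr prefix_order.le_less_trans prefix_order.less_imp_le by blast
      then have subr: "tree_path r q \<subseteq> S"
        using prefix_order.trans by (auto simp: jq tree_path_def)
      have "v t = 0" if "t \<in> S - tree_path r q" for t
      proof (rule ccontr)
        assume "v t \<noteq> 0"
        then have "length r \<le> length t" using v[of t] rq by linarith
        moreover have "prefix t q" using that by (simp add: jq tree_path_def)
        ultimately have "prefix r t" using prefix_length_prefix rq by blast
        then show False using that unfolding jq tree_path_def by blast
      qed
      then have "b = (\<Sum>t\<in>tree_path r q. v t)"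
        unfolding b_def using subr fin by (intro sum.mono_neutral_right) auto
      moreover have "tree_path r q \<subseteq> {t. strict_prefix p t}"
        using pr prefix_order.less_le_trans by (auto simp: tree_path_def)
      ultimately show ?thesis using below[OF is_segment_tree_path[OF rq(1)]] by simp
    qed
    define z where "z = \<sigma> p * m p + b"
    have z: "0 \<le> \<sigma> p * z" "\<sigma> p * z \<le> 2 * m p" "z\<^sup>2 \<le> 2 * (m p)\<^sup>2 + 2 * b\<^sup>2"
    proof -
      show "0 \<le> \<sigma> p * z" "\<sigma> p * z \<le> 2 * m p" using \<sigma>[of p] b by (auto simp: z_def)
      have "z\<^sup>2 \<le> 2 * (\<sigma> p * m p)\<^sup>2 + 2 * b\<^sup>2"
        unfolding z_def using zero_le_power2[of "\<sigma> p * m p - b"]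
        by (simp add: power2_sum power2_diff)
      then show "z\<^sup>2 \<le> 2 * (m p)\<^sup>2 + 2 * b\<^sup>2" using \<sigma>[of p] by auto
    qed
    then have z2: "\<beta>\<^sup>2 * z\<^sup>2 \<le> 2 * \<beta>\<^sup>2 * (m p)\<^sup>2 + 2 * \<beta>\<^sup>2 * b\<^sup>2"
      using mult_left_mono[OF z(3), of "\<beta>\<^sup>2"] by (simp add: algebra_simps)
    have az: "a j * z = (\<sigma> p * a j) * (\<sigma> p * z)" using \<sigma>[of p] by auto
    have expand: "(a j + \<beta> * z)\<^sup>2 = (a j)\<^sup>2 + 2 * \<beta> * (a j * z) + \<beta>\<^sup>2 * z\<^sup>2"
      by (simp add: power2_sum power_mult_distrib)
    show ?thesis
    proof (cases "\<sigma> p * a j \<le> 2 * \<beta> * m p")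
      case True
      have "a j * z \<le> (2 * \<beta> * m p) * (2 * m p)"
        unfolding az using True z m[of p] \<beta>
        by (intro order_trans[OF mult_right_mono[OF True z(1)]] mult_left_mono) auto
      then have "2 * \<beta> * (a j * z) \<le> 8 * \<beta>\<^sup>2 * (m p)\<^sup>2"
        using mult_left_mono[of "a j * z" "(2 * \<beta> * m p) * (2 * m p)" "2 * \<beta>"] \<beta>
        by (simp add: power2_eq_square algebra_simps)
      then have "(a j + \<beta> * z)\<^sup>2 \<le> (a j)\<^sup>2 + 10 * \<beta>\<^sup>2 * (m p)\<^sup>2 + 2 * \<beta>\<^sup>2 * b\<^sup>2"
        unfolding expand using z2 by linarith
      then show ?thesis
        unfolding sum us ws Sp using sub is_segment_tree_path[OF jp]
        by (intro exI[of _ "tree_path j p"] exI[of _ "{}"]) (simp add: a_def b_def z_def)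
    next
      case False
      then obtain k where k: "strict_prefix j k" "prefix k p" "\<sigma> p * a k \<le> - (2 * \<beta> * m p)"
        using sgn[OF jp] unfolding a_def by (auto simp: not_le)
      define d where "d = (\<Sum>t\<in>tree_path j (butlast k). u t)"
      have aj: "a j = d + a k"
        unfolding a_def d_def using split_tree_path[OF k(1,2)]
        by (simp add: sum.union_disjoint finite_tree_path)
      have "0 \<le> 2 * \<beta> * m p" using \<beta> m[of p] by simp
      then have nn: "0 \<le> \<sigma> p * a j" using False by linarith
      have "(\<sigma> p * a j) * (\<sigma> p * z) \<le> (\<sigma> p * a j) * (2 * m p)"
        using z m[of p] \<beta> by (intro mult_left_mono nn) simp_all
      also have "\<beta> * \<dots> = (\<sigma> p * a j) * (2 * \<beta> * m p)" by simp
      finally have 1: "\<beta> * (a j * z) \<le> (\<sigma> p * a j) * (2 * \<beta> * m p)"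
        unfolding az using \<beta> by (simp add: mult_left_mono)
      have "(\<sigma> p * a j) * (\<sigma> p * a k) \<le> (\<sigma> p * a j) * (- (2 * \<beta> * m p))"
        using k(3) by (intro mult_left_mono nn) simp_all
      moreover have "(\<sigma> p * a j) * (\<sigma> p * a k) = a j * a k" using \<sigma>[of p] by auto
      ultimately have "\<beta> * (a j * z) \<le> - (a j * a k)" using 1 by simp
      \<comment> \<open>The product of \<open>a j\<close> and \<open>a k\<close> is at most zero, so cutting at \<open>k\<close> raises the square sum by at
        least twice its modulus.\<close>
      moreover have "d\<^sup>2 + (a k)\<^sup>2 = (a j)\<^sup>2 - 2 * (a j * a k) + 2 * (a k)\<^sup>2"
        unfolding aj by (simp add: power2_eq_square algebra_simps)
      ultimately have "(a j)\<^sup>2 + 2 * \<beta> * (a j * z) \<le> d\<^sup>2 + (a k)\<^sup>2"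
        using zero_le_power2[of "a k"] by linarith
      then have "(a j + \<beta> * z)\<^sup>2 \<le> d\<^sup>2 + (a k)\<^sup>2 + 10 * \<beta>\<^sup>2 * (m p)\<^sup>2 + 2 * \<beta>\<^sup>2 * b\<^sup>2"
        unfolding expand using z2 mult_nonneg_nonneg[OF zero_le_power2[of \<beta>] zero_le_power2[of "m p"]]
        by linarith
      then show ?thesis
        unfolding sum us ws Sp
        using sub is_segment_tree_path[OF k(2)] is_segment_tree_path[OF split_tree_path(3)[OF k(1,2)]]
          split_tree_path(1,2)[OF k(1,2)]
        by (intro exI[of _ "tree_path j (butlast k)"] exI[of _ "tree_path k p"])
          (simp add: a_def b_def z_def d_def)
    qed
  qed
qed

text \<open>The heart of the argument. Without \<open>w\<close> the norm of \<open>u + \<beta> v\<close> can be as large as \<open>1 + \<beta>\<close>: take for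
  \<open>u\<close> and \<open>v\<close> unit vectors at two comparable nodes. At each node \<open>p\<close> of level \<open>N\<close> the correction \<open>w\<close> has modulus
  \<open>m p\<close>, which dominates all segment sums of \<open>v\<close> below \<open>p\<close>, and sign \<open>\<sigma> p\<close>. Hence every segment that passes through
  \<open>p\<close> has a \<open>(w + v)\<close>-sum of the sign \<open>\<sigma> p\<close> or zero. As the trees below distinct nodes of level \<open>N\<close> are disjoint, the
  squares \<open>(m p)\<^sup>2\<close> add up to at most 4, and \<open>crossing_estimate\<close> can be summed over any family of
  disjoint segments; the total excess is at most \<open>(10 \<cdot> 4 + 2) \<beta>\<^sup>2\<close>.\<close>

lemma gap_correction:
  fixes u v :: "node \<Rightarrow> real"
  assumes u: "jt_bounded u" "jt_norm u \<le> 1" "\<And>t. length t \<ge> N \<Longrightarrow> u t = 0"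
    and v: "jt_bounded v" "jt_norm v \<le> 1" "\<And>t. length t \<le> N \<Longrightarrow> v t = 0"
    and \<beta>: "\<beta> \<ge> 0"
  obtains w where "\<And>t. length t \<noteq> N \<Longrightarrow> w t = 0"
    "jt_norm (\<lambda>t. u t + \<beta> * (w t + v t)) \<le> sqrt (1 + 42 * \<beta>\<^sup>2)"
proof -
  have "\<exists>A. (A = {} \<or> is_segment A) \<and> A \<subseteq> {t. strict_prefix p t} \<and>
      (\<forall>S. is_segment S \<longrightarrow> S \<subseteq> {t. strict_prefix p t} \<longrightarrow> \<bar>\<Sum>t\<in>S. v t\<bar> \<le> 2 * \<bar>\<Sum>t\<in>A. v t\<bar>)" for p
    using near_maximal_segment[OF v(1), of "{t. strict_prefix p t}"] by metis
  then obtain A where A: "\<And>p. A p = {} \<or> is_segment (A p)" "\<And>p. A p \<subseteq> {t. strict_prefix p t}"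
    "\<And>p S. is_segment S \<Longrightarrow> S \<subseteq> {t. strict_prefix p t} \<Longrightarrow> \<bar>\<Sum>t\<in>S. v t\<bar> \<le> 2 * \<bar>\<Sum>t\<in>A p. v t\<bar>"
    by metis
  define m where "m p = 2 * \<bar>\<Sum>t\<in>A p. v t\<bar>" for p
  have m: "m p \<ge> 0" for p by (simp add: m_def)
  have "\<exists>\<sigma>\<in>{1,-1::real}. \<forall>j. prefix j p \<longrightarrow> \<sigma> * (\<Sum>t\<in>tree_path j p. u t) > 2 * \<beta> * m p \<longrightarrow>
     (\<exists>k. strict_prefix j k \<and> prefix k p \<and> \<sigma> * (\<Sum>t\<in>tree_path k p. u t) \<le> - (2 * \<beta> * m p))" for p
    using \<beta> m by (intro crossing_sign) simp
  then obtain \<sigma> where \<sigma>: "\<And>p. \<sigma> p \<in> {1,-1::real}"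
    "\<And>p j. prefix j p \<Longrightarrow> \<sigma> p * (\<Sum>t\<in>tree_path j p. u t) > 2 * \<beta> * m p \<Longrightarrow>
     (\<exists>k. strict_prefix j k \<and> prefix k p \<and> \<sigma> p * (\<Sum>t\<in>tree_path k p. u t) \<le> - (2 * \<beta> * m p))"
    by metis
  define w where "w t = (if length t = N then \<sigma> t * m t else 0)" for t
  define L where "L = {p::node. length p = N}"
  have finL: "finite L"
    unfolding L_def using finite_lists_length_eq[of "UNIV :: bool set" N] by simp
  have "disjoint_family_on A L"
  proof (unfold disjoint_family_on_def, intro ballI impI)
    fix p q assume pq: "p \<in> L" "q \<in> L" "p \<noteq> q"
    then have "\<not> (strict_prefix p t \<and> strict_prefix q t)" for t
      by (auto simp: L_def strict_prefix_def prefix_def)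
    then show "A p \<inter> A q = {}" using A(2)[of p] A(2)[of q] by blast
  qed
  then have "(\<Sum>p\<in>L. (\<Sum>t\<in>A p. v t)\<^sup>2) \<le> (jt_norm v)\<^sup>2"
    using A(1) finL v(1) by (intro sum_squares_le_jt_norm) auto
  also have "\<dots> \<le> 1" using v jt_norm_nonneg[OF v(1)] by (simp add: power_le_one)
  finally have sum_m: "(\<Sum>p\<in>L. (m p)\<^sup>2) \<le> 4"
    by (simp add: m_def power_mult_distrib sum_distrib_left[symmetric])
  have "jt_norm (\<lambda>t. u t + \<beta> * (w t + v t)) \<le> sqrt (1 + 42 * \<beta>\<^sup>2)"
  proof (rule jt_norm_leI)
    fix F assume F: "F \<in> segment_families"
    then have finF: "finite F" and seg: "\<And>S. S \<in> F \<Longrightarrow> is_segment S"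
      and dis: "\<And>S T. S \<in> F \<Longrightarrow> T \<in> F \<Longrightarrow> S \<noteq> T \<Longrightarrow> S \<inter> T = {}"
      by (auto simp: segment_families_def pairwise_def disjnt_def)
    define good where "good S A B \<longleftrightarrow> A \<union> B \<subseteq> S \<and> A \<inter> B = {} \<and>
        (A = {} \<or> is_segment A) \<and> (B = {} \<or> is_segment B) \<and>
        (\<Sum>t\<in>S. u t + \<beta> * (w t + v t))\<^sup>2 \<le> (\<Sum>t\<in>A. u t)\<^sup>2 + (\<Sum>t\<in>B. u t)\<^sup>2
         + 10 * \<beta>\<^sup>2 * (\<Sum>p\<in>S \<inter> L. (m p)\<^sup>2) + 2 * \<beta>\<^sup>2 * (\<Sum>t\<in>S. v t)\<^sup>2" for S A B
    have "\<exists>A B. good S A B" if "S \<in> F" for S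
      unfolding good_def L_def
      by (rule crossing_estimate[OF u(3) v(3) w_def m \<beta> A(3)[folded m_def] \<sigma> seg[OF that]])
    then obtain B C where good: "\<And>S. S \<in> F \<Longrightarrow> good S (B S) (C S)" by metis
    then have BC: "\<And>S. S \<in> F \<Longrightarrow> B S \<union> C S \<subseteq> S" "\<And>S. S \<in> F \<Longrightarrow> B S \<inter> C S = {}"
      "\<And>S. S \<in> F \<Longrightarrow> B S = {} \<or> is_segment (B S)" "\<And>S. S \<in> F \<Longrightarrow> C S = {} \<or> is_segment (C S)"
      and est: "\<And>S. S \<in> F \<Longrightarrow> (\<Sum>t\<in>S. u t + \<beta> * (w t + v t))\<^sup>2 \<le> (\<Sum>t\<in>B S. u t)\<^sup>2 + (\<Sum>t\<in>C S. u t)\<^sup>2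
         + 10 * \<beta>\<^sup>2 * (\<Sum>p\<in>S \<inter> L. (m p)\<^sup>2) + 2 * \<beta>\<^sup>2 * (\<Sum>t\<in>S. v t)\<^sup>2"
      unfolding good_def by blast+
    \<comment> \<open>Both pieces of all segments together form one admissible family for \<open>u\<close>.\<close>
    define D where "D = (\<lambda>(S, c). if c then B S else C S)"
    have "(\<Sum>i\<in>F \<times> (UNIV :: bool set). (\<Sum>t\<in>D i. u t)\<^sup>2) \<le> (jt_norm u)\<^sup>2"
    proof (rule sum_squares_le_jt_norm[OF u(1)])
      show "finite (F \<times> (UNIV :: bool set))" using finF by simp
      show "disjoint_family_on D (F \<times> (UNIV :: bool set))"
        using BC(1,2) dis unfolding disjoint_family_on_def D_def
        by (auto split: if_splits) blast+
      show "D i = {} \<or> is_segment (D i)" if "i \<in> F \<times> (UNIV :: bool set)" for i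
        using that BC(3)[of "fst i"] BC(4)[of "fst i"] by (cases i) (auto simp: D_def split: if_splits)
    qed
    also have "\<dots> \<le> 1" using u jt_norm_nonneg[OF u(1)] by (simp add: power_le_one)
    finally have "(\<Sum>i\<in>F \<times> (UNIV :: bool set). (\<Sum>t\<in>D i. u t)\<^sup>2) \<le> 1" .
    moreover have "(\<Sum>i\<in>F \<times> (UNIV :: bool set). (\<Sum>t\<in>D i. u t)\<^sup>2) =
        (\<Sum>S\<in>F. \<Sum>c\<in>(UNIV :: bool set). (\<Sum>t\<in>D (S, c). u t)\<^sup>2)"
      by (simp add: sum.cartesian_product split_beta)
    ultimately have su: "(\<Sum>S\<in>F. (\<Sum>t\<in>B S. u t)\<^sup>2 + (\<Sum>t\<in>C S. u t)\<^sup>2) \<le> 1"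
      by (simp add: D_def UNIV_bool add.commute)
    have "(\<Sum>S\<in>F. (\<Sum>t\<in>S. v t)\<^sup>2) \<le> (jt_norm v)\<^sup>2"
      using sum_squares_le_jt_norm[OF v(1) finF, of id] seg dis
      by (auto simp: disjoint_family_on_def)
    also have "\<dots> \<le> 1" using v jt_norm_nonneg[OF v(1)] by (simp add: power_le_one)
    finally have sv: "(\<Sum>S\<in>F. (\<Sum>t\<in>S. v t)\<^sup>2) \<le> 1" .
    have "(\<Sum>S\<in>F. \<Sum>p\<in>S \<inter> L. (m p)\<^sup>2) = (\<Sum>p\<in>(\<Union>S\<in>F. S \<inter> L). (m p)\<^sup>2)"
      using finF finL dis by (intro sum.UNION_disjoint[symmetric]) auto
    also have "\<dots> \<le> (\<Sum>p\<in>L. (m p)\<^sup>2)"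
      using finL by (intro sum_mono2) auto
    finally have sm: "(\<Sum>S\<in>F. \<Sum>p\<in>S \<inter> L. (m p)\<^sup>2) \<le> 4" using sum_m by simp
    have "(\<Sum>S\<in>F. (\<Sum>t\<in>S. u t + \<beta> * (w t + v t))\<^sup>2) \<le>
      (\<Sum>S\<in>F. (\<Sum>t\<in>B S. u t)\<^sup>2 + (\<Sum>t\<in>C S. u t)\<^sup>2
         + 10 * \<beta>\<^sup>2 * (\<Sum>p\<in>S \<inter> L. (m p)\<^sup>2) + 2 * \<beta>\<^sup>2 * (\<Sum>t\<in>S. v t)\<^sup>2)"
      by (intro sum_mono est)
    also have "\<dots> = (\<Sum>S\<in>F. (\<Sum>t\<in>B S. u t)\<^sup>2 + (\<Sum>t\<in>C S. u t)\<^sup>2)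
         + 10 * \<beta>\<^sup>2 * (\<Sum>S\<in>F. \<Sum>p\<in>S \<inter> L. (m p)\<^sup>2) + 2 * \<beta>\<^sup>2 * (\<Sum>S\<in>F. (\<Sum>t\<in>S. v t)\<^sup>2)"
      by (simp add: sum.distrib sum_distrib_left)
    also have "\<dots> \<le> 1 + 10 * \<beta>\<^sup>2 * 4 + 2 * \<beta>\<^sup>2 * 1"
      by (intro add_mono mult_left_mono su sm sv) auto
    finally show "jt_value F (\<lambda>t. u t + \<beta> * (w t + v t)) \<le> sqrt (1 + 42 * \<beta>\<^sup>2)"
      unfolding jt_value_def by simp
  qed
  then show thesis using that[of w] by (simp add: w_def)
qed

section \<open>Vectors supported on ranges of levels\<close>

lemma finite_levels: "finite {t :: node. length t < N}" "finite {t :: node. length t \<le> N}"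
proof -
  show le: "finite {t :: node. length t \<le> N}" for N
    using finite_lists_length_le[of "UNIV :: bool set" N] by simp
  show "finite {t :: node. length t < N}"
    by (rule finite_subset[OF _ le[of N]]) auto
qed

lemma segment_Int_levels:
  assumes S: "is_segment S" and P: "\<And>a b c. a \<in> P \<Longrightarrow> c \<in> P \<Longrightarrow> a \<le> b \<Longrightarrow> b \<le> c \<Longrightarrow> b \<in> P"
  shows "S \<inter> {t. length t \<in> P} = {} \<or> is_segment (S \<inter> {t. length t \<in> P})"
proof (cases "S \<inter> {t. length t \<in> P} = {}")
  case False
  obtain p q where pq: "S = tree_path p q" using is_segment_imp_tree_path[OF S] by blast
  let ?A = "S \<inter> {t. length t \<in> P}"
  have A: "finite ?A" "?A \<noteq> {}" using False pq finite_tree_path by auto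
  obtain r where r: "r \<in> ?A" "\<And>x. x \<in> ?A \<Longrightarrow> length r \<le> length x"
    using arg_min_if_finite[OF A, of length] by (meson not_less)
  have "Max (length ` ?A) \<in> length ` ?A" using A by (intro Max_in) auto
  then obtain s where s: "s \<in> ?A" "length s = Max (length ` ?A)" by auto
  have s': "length x \<le> length s" if "x \<in> ?A" for x
    using that A(1) unfolding s(2) by (intro Max_ge) auto
  have pre: "prefix x y" if "x \<in> ?A" "y \<in> ?A" "length x \<le> length y" for x y
    using that prefix_length_prefix[of x q y] by (simp add: pq tree_path_def)
  have "?A \<subseteq> tree_path r s"
    using pre[OF r(1) _ r(2)] pre[OF _ s(1) s'] unfolding tree_path_def[of r s] by blast
  moreover have "x \<in> ?A" if "x \<in> tree_path r s" for x
  proof -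
    have x: "prefix r x" "prefix x s" using that by (auto simp: tree_path_def)
    then have "x \<in> S" using r(1) s(1) prefix_order.trans unfolding pq tree_path_def by blast
    moreover have "length x \<in> P"
      using P[of "length r" "length s" "length x"] r(1) s(1) x[THEN prefix_length_le] by simp
    ultimately show ?thesis by simp
  qed
  ultimately have "?A = tree_path r s" by blast
  then show ?thesis using is_segment_tree_path[OF pre[OF r(1) s(1) r(2)[OF s(1)]]] by simp
qed simp

text \<open>A range of consecutive levels meets each segment in a segment, so each square sum of the
  restriction of \<open>x\<close> is also a square sum of \<open>x\<close>.\<close>

lemma jt_norm_restrict_levels:
  assumes x: "jt_bounded x" and P: "\<And>a b c. a \<in> P \<Longrightarrow> c \<in> P \<Longrightarrow> a \<le> b \<Longrightarrow> b \<le> c \<Longrightarrow> b \<in> P"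
  shows "jt_norm (\<lambda>t. if length t \<in> P then x t else 0) \<le> jt_norm x"
proof (rule jt_norm_leI)
  fix F assume F: "F \<in> segment_families"
  then have finF: "finite F" and seg: "\<And>S. S \<in> F \<Longrightarrow> is_segment S"
    and dis: "\<And>S T. S \<in> F \<Longrightarrow> T \<in> F \<Longrightarrow> S \<noteq> T \<Longrightarrow> S \<inter> T = {}"
    by (auto simp: segment_families_def pairwise_def disjnt_def)
  have fin: "finite S" if "S \<in> F" for S
    using is_segment_finite[OF seg[OF that]] .
  have "(\<Sum>S\<in>F. (\<Sum>t\<in>S \<inter> {t. length t \<in> P}. x t)\<^sup>2) \<le> (jt_norm x)\<^sup>2"
  proof (rule sum_squares_le_jt_norm[OF x finF])
    show "disjoint_family_on (\<lambda>S. S \<inter> {t. length t \<in> P}) F"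
      using dis unfolding disjoint_family_on_def by blast
  qed (rule segment_Int_levels[OF seg P])
  moreover have "(\<Sum>t\<in>S. if length t \<in> P then x t else 0) = (\<Sum>t\<in>S \<inter> {t. length t \<in> P}. x t)"
    if "S \<in> F" for S
    using fin[OF that] by (simp add: sum.inter_restrict)
  ultimately have "(\<Sum>S\<in>F. (\<Sum>t\<in>S. if length t \<in> P then x t else 0)\<^sup>2) \<le> (jt_norm x)\<^sup>2"
    by simp
  then show "jt_value F (\<lambda>t. if length t \<in> P then x t else 0) \<le> jt_norm x"
    unfolding jt_value_def using jt_norm_nonneg[OF x] by (simp add: real_le_lsqrt)
qed

lemma jt_eqI: "(\<And>t. jt_fun x t = jt_fun y t) \<Longrightarrow> x = y"
  by (simp add: jt_fun_inject[symmetric] fun_eq_iff)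

lemma jt_fun_finite_sum:
  assumes "finite T"
  shows "jt_fun (\<Sum>t\<in>T. c t *\<^sub>R jt_basis t) s = (if s \<in> T then c s else 0)"
  using assms by (simp add: jt_fun_sum scaleR_jt.rep_eq jt_basis.rep_eq if_distrib cong: if_cong)

lemma truncate_levels:
  obtains y where "\<And>t. jt_fun y t = (if length t < N then jt_fun x t else 0)"
    "norm y \<le> norm x" "norm (x - y) \<le> norm x"
proof -
  define y where "y = (\<Sum>t\<in>{t. length t < N}. jt_fun x t *\<^sub>R jt_basis t)"
  have y: "jt_fun y t = (if length t < N then jt_fun x t else 0)" for t
    unfolding y_def by (simp add: jt_fun_finite_sum finite_levels)
  have "jt_fun y = (\<lambda>t. if length t \<in> {..<N} then jt_fun x t else 0)"
    "jt_fun (x - y) = (\<lambda>t. if length t \<in> {N..} then jt_fun x t else 0)"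
    using y by (auto simp: fun_eq_iff minus_jt.rep_eq)
  then have "norm y \<le> norm x" "norm (x - y) \<le> norm x"
    using jt_norm_restrict_levels[OF jt_fun_bounded[of x], of "{..<N}"]
      jt_norm_restrict_levels[OF jt_fun_bounded[of x], of "{N..}"]
    by (simp_all add: norm_jt.rep_eq)
  with y that show thesis by blast
qed

lemma jt_gap_correction:
  assumes u: "norm u \<le> 1" "\<And>t. length t \<ge> N \<Longrightarrow> jt_fun u t = 0"
    and v: "norm v \<le> 1" "\<And>t. length t \<le> N \<Longrightarrow> jt_fun v t = 0"
    and \<beta>: "\<beta> \<ge> 0"
  obtains w where "\<And>t. length t \<noteq> N \<Longrightarrow> jt_fun w t = 0"
    "norm (u + \<beta> *\<^sub>R (w + v)) \<le> sqrt (1 + 42 * \<beta>\<^sup>2)"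
proof -
  obtain w where w: "\<And>t. length t \<noteq> N \<Longrightarrow> w t = 0"
    "jt_norm (\<lambda>t. jt_fun u t + \<beta> * (w t + jt_fun v t)) \<le> sqrt (1 + 42 * \<beta>\<^sup>2)"
    using gap_correction[OF jt_fun_bounded _ u(2) jt_fun_bounded _ v(2) \<beta>] u(1) v(1)
    by (auto simp: norm_jt.rep_eq)
  have "finitely_supported w"
    unfolding finitely_supported_def
    by (rule finite_subset[OF _ finite_levels(2)[of N]]) (use w(1) in force)
  then have "jt_fun (Abs_jt w) = w"
    by (simp add: Abs_jt_inverse finitely_supported_jt_carrier)
  with w show thesis
    by (intro that[of "Abs_jt w"]) (simp_all add: norm_jt.rep_eq plus_jt.rep_eq scaleR_jt.rep_eq)
qed

section \<open>Functionals in the predual\<close>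

lemma blinfun_almost_normed:
  fixes f :: "'a::real_normed_vector \<Rightarrow>\<^sub>L real"
  assumes "\<delta> > 0"
  obtains z where "norm z \<le> 1" "norm f - \<delta> \<le> blinfun_apply f z"
proof -
  have "\<exists>z. norm z \<le> 1 \<and> norm f - \<delta> \<le> blinfun_apply f z"
  proof (rule ccontr)
    assume "\<not> ?thesis"
    then have less: "blinfun_apply f z < norm f - \<delta>" if "norm z \<le> 1" for z
      using that by (meson not_le)
    have pos: "0 < norm f - \<delta>" using less[of 0] by simp
    have le: "blinfun_apply f z \<le> (norm f - \<delta>) * norm z" for z
    proof (cases "z = 0")
      case False
      then have "blinfun_apply f (z /\<^sub>R norm z) \<le> norm f - \<delta>" by (intro less_imp_le[OF less]) simp
      then show ?thesis using False by (simp add: blinfun.scaleR_right field_simps)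
    qed simp
    have "norm f \<le> norm f - \<delta>"
    proof (rule norm_blinfun_bound)
      show "norm (blinfun_apply f z) \<le> (norm f - \<delta>) * norm z" for z
        using le[of z] le[of "- z"] by (simp add: blinfun.minus_right abs_le_iff)
    qed (use pos in simp)
    then show False using assms by simp
  qed
  then show thesis using that by blast
qed

text \<open>The functionals in the span of the coordinates are the finitely supported ones; they are dense
  in the predual and ignore all sufficiently deep levels.\<close>

lemma span_coord_low:
  assumes "f \<in> span (range jt_coord)"
  obtains N where "\<And>z. (\<And>t. length t < N \<Longrightarrow> jt_fun z t = 0) \<Longrightarrow> blinfun_apply f z = 0"
proof -
  have "\<exists>N. \<forall>z. (\<forall>t. length t < N \<longrightarrow> jt_fun z t = 0) \<longrightarrow> blinfun_apply f z = 0"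
    using assms
  proof (induction rule: span_induct_alt)
    case base
    show ?case by simp
  next
    case (step c g f)
    from step(1) obtain s where "g = jt_coord s" by auto
    moreover from step(2) obtain N where
      "\<And>z. (\<forall>t. length t < N \<longrightarrow> jt_fun z t = 0) \<Longrightarrow> blinfun_apply f z = 0" by blast
    ultimately show ?case
      by (intro exI[of _ "max N (Suc (length s))"])
        (simp add: blinfun.add_left blinfun.scaleR_left jt_coord.rep_eq)
  qed
  then show thesis using that by blast
qed

lift_definition predual_eval :: "jt \<Rightarrow> jt_predual \<Rightarrow>\<^sub>L real" is
  "\<lambda>z y. blinfun_apply (predual_functional y) z"
proof (rule bounded_linear_intro)
  show "norm (blinfun_apply (predual_functional y) z) \<le> norm y * norm z" for z y
    unfolding norm_jt_predual.rep_eq by (rule norm_blinfun)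
qed (simp_all add: plus_jt_predual.rep_eq scaleR_jt_predual.rep_eq blinfun.add_left blinfun.scaleR_left)

text \<open>The subspaces of finite codimension used in the lower estimate: functionals supported on the
  levels beyond \<open>N\<close>.\<close>

definition low_annihilator :: "nat \<Rightarrow> jt_predual set" where
  "low_annihilator N =
    {y. \<forall>t. length t \<le> N \<longrightarrow> blinfun_apply (predual_functional y) (jt_basis t) = 0}"

lemma low_annihilator_finite_codim: "low_annihilator N \<in> finite_codim_closed_subspaces"
proof -
  define M where "M = card {t::node. length t \<le> N}"
  obtain h where "bij_betw h {1..M} {t::node. length t \<le> N}"
    using ex_bij_betw_nat_finite_1[OF finite_levels(2)[of N]] unfolding M_def by blast
  then have h: "h ` {1..M} = {t. length t \<le> N}" by (rule bij_betw_imp_surj_on)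
  have "(\<forall>t. length t \<le> N \<longrightarrow> Q t) \<longleftrightarrow> (\<forall>i\<in>{1..M}. Q (h i))" for Q
  proof -
    have "(\<forall>t. length t \<le> N \<longrightarrow> Q t) \<longleftrightarrow> (\<forall>t\<in>h ` {1..M}. Q t)" unfolding h by simp
    then show ?thesis by simp
  qed
  then have "low_annihilator N =
      {y. \<forall>i\<in>{1..M}. blinfun_apply (predual_eval (jt_basis (h i))) y = 0}"
    unfolding low_annihilator_def predual_eval.rep_eq by simp
  then show ?thesis unfolding finite_codim_closed_subspaces_def
    by (intro CollectI exI[of _ M] exI[of _ "\<lambda>i. predual_eval (jt_basis (h i))"])
qed

lemma low_annihilator_vanishes:
  assumes "y \<in> low_annihilator N" "\<And>t. length t > N \<Longrightarrow> jt_fun z t = 0"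
  shows "blinfun_apply (predual_functional y) z = 0"
proof -
  have "z = (\<Sum>t\<in>{t. length t \<le> N}. jt_fun z t *\<^sub>R jt_basis t)"
    using assms(2) by (intro jt_eqI) (simp add: jt_fun_finite_sum finite_levels not_le)
  also have "blinfun_apply (predual_functional y) \<dots> = 0"
    using assms(1) by (simp add: blinfun.sum_right blinfun.scaleR_right low_annihilator_def)
  finally show ?thesis .
qed

lemma low_annihilator_sphere: "low_annihilator N \<inter> sphere 0 1 \<noteq> {}"
proof -
  define s where "s = replicate (Suc N) True"
  define y where "y = Abs_jt_predual (jt_coord s)"
  have "jt_coord s \<in> closure (span (range jt_coord))"
    by (intro subsetD[OF closure_subset] span_base) simp
  then have y: "predual_functional y = jt_coord s" by (simp add: y_def Abs_jt_predual_inverse)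
  then have "predual_functional y \<noteq> 0" using jt_coord_basis[of s s] by auto
  then have "norm y \<noteq> 0" by (simp add: norm_jt_predual.rep_eq)
  then have "inverse (norm y) *\<^sub>R y \<in> low_annihilator N \<inter> sphere 0 1"
    using y by (auto simp: low_annihilator_def scaleR_jt_predual.rep_eq blinfun.scaleR_left
        jt_coord_basis s_def)
  then show ?thesis by blast
qed

section \<open>The lower estimate of the modulus\<close>

text \<open>Test \<open>x + \<epsilon> y\<close> against \<open>q = u + \<beta> (w + v)\<close>, where \<open>u\<close> almost norms \<open>x\<close>, \<open>v\<close> almost norms \<open>y\<close>, and \<open>w\<close>
  comes from \<open>jt_gap_correction\<close>. Up to a small error, \<open>x\<close> sees only \<open>u\<close>, while \<open>y\<close> sees only \<open>\<beta> v\<close>.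
  The gain \<open>\<epsilon> \<beta>\<close> beats the increase \<open>21 \<beta>\<^sup>2\<close> of the norm of \<open>q\<close> when \<open>\<beta> = \<epsilon> / 42\<close>, the maximizer of
  \<open>\<epsilon> \<beta> - 21 \<beta>\<^sup>2\<close>; this leaves nearly \<open>\<epsilon>\<^sup>2 / 84\<close>.\<close>

lemma predual_asymptotic_estimate:
  assumes x: "norm (x :: jt_predual) = 1" and \<epsilon>: "0 < \<epsilon>" "\<epsilon> \<le> 1"
  obtains N where "\<And>y. y \<in> low_annihilator N \<Longrightarrow> norm y = 1 \<Longrightarrow> \<epsilon>\<^sup>2 / 200 \<le> norm (x + \<epsilon> *\<^sub>R y) - 1"
proof -
  define e where "e = \<epsilon>\<^sup>2"
  have e: "0 < e" "e \<le> 1" using \<epsilon> by (auto simp: e_def power_le_one)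
  \<comment> \<open>Small enough for all approximation errors to fit between \<open>e / 84\<close> and \<open>e / 200\<close>.\<close>
  define \<delta> where "\<delta> = e / 10000"
  have \<delta>: "\<delta> > 0" using e by (simp add: \<delta>_def)
  obtain f where f: "f \<in> span (range jt_coord)" "dist f (predual_functional x) < \<delta>"
    using predual_functional[of x] \<delta> unfolding closure_approachable by blast
  obtain N where N: "\<And>z. (\<And>t. length t < N \<Longrightarrow> jt_fun z t = 0) \<Longrightarrow> blinfun_apply f z = 0"
    using span_coord_low[OF f(1)] by blast
  have close: "\<bar>blinfun_apply f z - blinfun_apply (predual_functional x) z\<bar> \<le> \<delta> * norm z" for z
  proof -
    have "\<bar>blinfun_apply (f - predual_functional x) z\<bar> \<le> norm (f - predual_functional x) * norm z"
      using norm_blinfun[of "f - predual_functional x" z] by simp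
    also have "\<dots> \<le> \<delta> * norm z"
      using f(2) by (intro mult_right_mono) (auto simp: dist_norm)
    finally show ?thesis by (simp add: blinfun.diff_left)
  qed
  have "e / 200 \<le> norm (x + \<epsilon> *\<^sub>R y) - 1" if y: "y \<in> low_annihilator N" "norm y = 1" for y
  proof -
    obtain u0 where u0: "norm u0 \<le> 1" "1 - \<delta> \<le> blinfun_apply (predual_functional x) u0"
      using blinfun_almost_normed[OF \<delta>, of "predual_functional x"] x by (auto simp: norm_jt_predual.rep_eq)
    obtain v0 where v0: "norm v0 \<le> 1" "1 - \<delta> \<le> blinfun_apply (predual_functional y) v0"
      using blinfun_almost_normed[OF \<delta>, of "predual_functional y"] y(2) by (auto simp: norm_jt_predual.rep_eq)
    obtain u where u: "\<And>t. jt_fun u t = (if length t < N then jt_fun u0 t else 0)" "norm u \<le> norm u0"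
      using truncate_levels[of N u0] by blast
    obtain v1 where v1: "\<And>t. jt_fun v1 t = (if length t < Suc N then jt_fun v0 t else 0)"
      "norm (v0 - v1) \<le> norm v0"
      using truncate_levels[of "Suc N" v0] by blast
    define v where "v = v0 - v1"
    define \<beta> where "\<beta> = \<epsilon> / 42"
    have v: "norm v \<le> 1" "\<And>t. jt_fun v t = (if length t \<le> N then 0 else jt_fun v0 t)"
      using v1 v0(1) by (auto simp: v_def minus_jt.rep_eq)
    obtain w where w: "\<And>t. length t \<noteq> N \<Longrightarrow> jt_fun w t = 0"
      "norm (u + \<beta> *\<^sub>R (w + v)) \<le> sqrt (1 + 42 * \<beta>\<^sup>2)"
      using jt_gap_correction[of u N v \<beta>] u u0(1) v \<epsilon> by (auto simp: \<beta>_def)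
    define q where "q = u + \<beta> *\<^sub>R (w + v)"
    have "sqrt (1 + 42 * \<beta>\<^sup>2) \<le> 1 + e / 84"
      by (rule real_le_lsqrt) (use e in \<open>auto simp: \<beta>_def e_def power2_sum power_divide\<close>)
    then have q: "norm q \<le> 1 + e / 84" using w(2) by (simp add: q_def)
    have "blinfun_apply f (q - u0) = 0"
      using u(1) v(2) w(1) by (intro N) (simp add: q_def minus_jt.rep_eq plus_jt.rep_eq scaleR_jt.rep_eq)
    then have "blinfun_apply f q = blinfun_apply f u0" by (simp add: blinfun.diff_right)
    moreover have "\<delta> * norm q \<le> \<delta> * 2" "\<delta> * norm u0 \<le> \<delta> * 1"
      using q e u0(1) \<delta> by (intro mult_left_mono; simp)+
    ultimately have xq: "1 - 4 * \<delta> \<le> blinfun_apply (predual_functional x) q"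
      using close[of q] close[of u0] u0(2) by linarith
    have "blinfun_apply (predual_functional y) (q - \<beta> *\<^sub>R v0) = 0"
      using u(1) v(2) w(1)
      by (intro low_annihilator_vanishes[OF y(1)])
        (simp add: q_def minus_jt.rep_eq plus_jt.rep_eq scaleR_jt.rep_eq)
    then have "blinfun_apply (predual_functional y) q = \<beta> * blinfun_apply (predual_functional y) v0"
      by (simp add: blinfun.diff_right blinfun.scaleR_right)
    then have "\<epsilon> * blinfun_apply (predual_functional y) q = (e / 42) * blinfun_apply (predual_functional y) v0"
      by (simp add: e_def \<beta>_def power2_eq_square)
    moreover have "(e / 42) * (1 - \<delta>) \<le> (e / 42) * blinfun_apply (predual_functional y) v0"
      using v0(2) e by (intro mult_left_mono) auto
    ultimately have "1 - 4 * \<delta> + (e / 42) * (1 - \<delta>) \<le> blinfun_apply (predual_functional (x + \<epsilon> *\<^sub>R y)) q"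
      using xq by (simp add: plus_jt_predual.rep_eq scaleR_jt_predual.rep_eq blinfun.add_left blinfun.scaleR_left)
    also have "\<dots> \<le> norm (x + \<epsilon> *\<^sub>R y) * norm q"
      using norm_blinfun[of "predual_functional (x + \<epsilon> *\<^sub>R y)" q] by (simp add: norm_jt_predual.rep_eq)
    also have "\<dots> \<le> norm (x + \<epsilon> *\<^sub>R y) * (1 + e / 84)"
      using q by (intro mult_left_mono) auto
    finally have up: "1 - 4 * \<delta> + (e / 42) * (1 - \<delta>) \<le> norm (x + \<epsilon> *\<^sub>R y) * (1 + e / 84)" .
    define s where "s = e * e"
    have s: "0 \<le> s" "s \<le> e" using e by (simp_all add: s_def mult_left_le)
    have "(1 + e / 200) * (1 + e / 84) = 1 + e / 200 + e / 84 + s / 16800"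
      by (simp add: s_def algebra_simps)
    also have "\<dots> \<le> 1 - 4 * (e / 10000) + e / 42 - s / 420000" using s e by linarith
    also have "\<dots> = 1 - 4 * \<delta> + (e / 42) * (1 - \<delta>)"
      by (simp add: s_def \<delta>_def algebra_simps)
    finally have "(1 + e / 200) * (1 + e / 84) \<le> 1 - 4 * \<delta> + (e / 42) * (1 - \<delta>)" .
    with up have "(1 + e / 200) * (1 + e / 84) \<le> norm (x + \<epsilon> *\<^sub>R y) * (1 + e / 84)" by linarith
    then have "1 + e / 200 \<le> norm (x + \<epsilon> *\<^sub>R y)"
      using e by (simp add: mult_le_cancel_right)
    then show ?thesis by simp
  qed
  then show thesis using that unfolding e_def by blast
qed

text \<open>A lower bound needs only one good subspace for each \<open>x\<close>, provided that the supremum over all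
  subspaces is bounded above.\<close>

lemma asymptotic_convexity_modulus_ge:
  fixes \<epsilon> c :: real
  assumes "\<And>x :: 'a :: infinite_dimensional_banach. norm x = 1 \<Longrightarrow> \<exists>Y\<in>finite_codim_closed_subspaces.
      Y \<inter> sphere 0 1 \<noteq> {} \<and> (\<forall>y\<in>Y \<inter> sphere 0 1. c \<le> norm (x + \<epsilon> *\<^sub>R y) - 1)"
    and ne: "sphere (0::'a) 1 \<noteq> {}"
  shows "c \<le> asymptotic_convexity_modulus TYPE('a) \<epsilon>"
  unfolding asymptotic_convexity_modulus_def
proof (rule cINF_greatest[OF ne])
  fix x :: 'a assume "x \<in> sphere 0 1"
  then have x: "norm x = 1" by simp
  let ?g = "\<lambda>Y. INF y \<in> Y \<inter> sphere 0 1. norm (x + \<epsilon> *\<^sub>R y) - 1"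
  obtain Y where Y: "Y \<in> finite_codim_closed_subspaces" "Y \<inter> sphere 0 1 \<noteq> {}"
    "\<forall>y\<in>Y \<inter> sphere 0 1. c \<le> norm (x + \<epsilon> *\<^sub>R y) - 1" using assms(1)[OF x] by blast
  \<comment> \<open>When the unit sphere of \<open>Z\<close> is empty, the infimum is the unspecified value \<open>Inf {}\<close>.\<close>
  have "?g Z \<le> max (Inf {}) \<bar>\<epsilon>\<bar>" for Z
  proof (cases "Z \<inter> sphere 0 1 = {}")
    case True
    show ?thesis unfolding True by simp
  next
    case False
    then obtain y where y: "y \<in> Z" "norm y = 1" by auto
    have "?g Z \<le> norm (x + \<epsilon> *\<^sub>R y) - 1"
      using y by (intro cINF_lower bdd_belowI[of _ "-1"]) auto
    also have "\<dots> \<le> \<bar>\<epsilon>\<bar>" using norm_triangle_ineq[of x "\<epsilon> *\<^sub>R y"] x y by simp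
    finally show ?thesis by simp
  qed
  then have "bdd_above (?g ` finite_codim_closed_subspaces)" by (intro bdd_aboveI2)
  moreover have "c \<le> ?g Y" using Y by (intro cINF_greatest) auto
  ultimately show "c \<le> (SUP Y\<in>finite_codim_closed_subspaces. ?g Y)"
    using Y(1) by (intro cSUP_upper2)
qed

theorem theorem3:
  shows "(\<exists>k::real. k > 0 \<and>
            (\<forall>\<epsilon>\<in>{0<..1}. asymptotic_convexity_modulus TYPE(jt_predual) \<epsilon> \<ge> k * \<epsilon> ^ 3)) \<and>
         asymptotically_uniformly_convex TYPE(jt_predual)"
proof -
  have bound: "(1 / 200) * \<epsilon> ^ 3 \<le> asymptotic_convexity_modulus TYPE(jt_predual) \<epsilon>"
    if \<epsilon>: "\<epsilon> \<in> {0<..1}" for \<epsilon> :: real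
  proof -
    have "\<epsilon> ^ 3 \<le> \<epsilon>\<^sup>2" using \<epsilon> by (intro power_decreasing) auto
    then have "(1 / 200) * \<epsilon> ^ 3 \<le> \<epsilon>\<^sup>2 / 200" by simp
    also have "\<dots> \<le> asymptotic_convexity_modulus TYPE(jt_predual) \<epsilon>"
    proof (rule asymptotic_convexity_modulus_ge)
      fix x :: jt_predual assume "norm x = 1"
      then obtain N where "\<And>y. y \<in> low_annihilator N \<Longrightarrow> norm y = 1 \<Longrightarrow> \<epsilon>\<^sup>2 / 200 \<le> norm (x + \<epsilon> *\<^sub>R y) - 1"
        using predual_asymptotic_estimate[of x \<epsilon>] \<epsilon> by auto
      then show "\<exists>Y\<in>finite_codim_closed_subspaces. Y \<inter> sphere 0 1 \<noteq> {} \<and>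
          (\<forall>y\<in>Y \<inter> sphere 0 1. \<epsilon>\<^sup>2 / 200 \<le> norm (x + \<epsilon> *\<^sub>R y) - 1)"
        using low_annihilator_finite_codim low_annihilator_sphere by (intro bexI[of _ "low_annihilator N"]) auto
    qed (use low_annihilator_sphere in blast)
    finally show ?thesis .
  qed
  moreover have "asymptotic_convexity_modulus TYPE(jt_predual) \<epsilon> > 0" if "\<epsilon> \<in> {0<..1}" for \<epsilon> :: real
    using bound[OF that] that by (intro less_le_trans[OF _ bound[OF that]]) simp
  ultimately show ?thesis
    unfolding asymptotically_uniformly_convex_def by (intro conjI exI[of _ "1 / 200"]) auto
qed

end
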